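(* (Inversion theorem) The following identities hold: $$\bar{\mathbf S}_1\circ\mathbf S_0=\mathrm{id}=\mathbf S_1\circ\bar{\mathbf S}_0,\qquad \bar{\mathbf S}_0\circ\mathbf S_1=\mathrm{id}=\mathbf S_0\circ\bar{\mathbf S}_1,$$ $$\mathbf E_1\circ\mathbf E_0=\mathrm{id}=\bar{\mathbf E}_1\circ\bar{\mathbf E}_0,\qquad \mathbf E_0\circ\mathbf E_1=\mathrm{id}=\bar{\mathbf E}_0\circ\bar{\mathbf E}_1 .$$
   Context: Let $q^{1/2},t^{1/2}$ be formal parameters, $t=q^k$, $\mathbb K=\mathbb C(q^{1/2},t^{1/2})$, $X=q^x$, $\mathcal P=\mathbb K[X^{\pm1}]$. The bar is the $\mathbb C$-linear ring involution $\bar X=X^{-1}$, $\overline{q^{1/2}}=q^{-1/2}$, $\overline{t^{1/2}}=t^{-1/2}$. The constant term of a Laurent series in $X$ is denoted $\langle\cdot\rangle$. Put $$\mu_k(x)=\prod_{j\ge0}\frac{(1-q^{j}X^2)(1-q^{j+1}X^{-2})}{(1-tq^{j}X^2)(1-tq^{j+1}X^{-2})},\qquad \mu_k^0=\mu_k/\langle\mu_k\rangle,$$ ($\mu_k$ is expanded in powers of $q,t$; the coefficients of $\mu_k^0$ are in $\mathbb Q(q,t)$). For $n\in\mathbb Z$ put $n_\#=(n+\mathrm{sgn}(n)k)/2$ with $\mathrm{sgn}(0)=-1$; the value of a Laurent polynomial at $n_\#$ is its value at $X=q^{n_\#}=q^{n/2}t^{\mathrm{sgn}(n)/2}$. Order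 monomials by: $X^m\prec X^n$ if $|m|<|n|$ or $m=-n>0$. The nonsymmetric polynomial $e_n\in\mathcal P$ is determined by $e_n=X^n+(\text{terms lower with respect to }\prec)$ and $\langle e_n X^{-m}\mu_k^0\rangle=0$ whenever $X^m\prec X^n$; $\varepsilon_n=e_n/e_n(-k/2)$. Let $\mathbb Z_\#=\{n_\#:n\in\mathbb Z\}$ and let $\mathcal F$ be the space of finitely supported $\mathbb K$-valued functions on $\mathbb Z_\#$, with $\bar f(n_\#)=\overline{f(n_\#)}$. For $n>0$ put $$\mu_k^1(n_\#)=\mu_k^1((1-n)_\#)=t^{-(n-1)}\prod_{j=1}^{n-1}\frac{1-t^2q^j}{1-q^j}.$$ The transforms from $\mathcal P$ to $\mathcal F$ are $$\mathbf S_0(f)(n_\#)=\langle f\varepsilon_n\mu_k^0\rangle,\ \ \mathbf E_0(f)(n_\#)=\langle\bar f\varepsilon_n\mu_k^0\rangle,\ \ \bar{\mathbf S}_0(f)(n_\#)=\langle f\overline{\varepsilon_n}\mu_k^0\rangle,\ \ \bar{\mathbf E}_0(f)(n_\#)=\langle\bar f\,\overline{\varepsilon_n}\mu_k^0\rangle.$$ The transforms from $\mathcal F$ to $\mathcal P$ are $$\mathbf S_1(f)=\sum_{n\in\mathbb Z} f(n_\#)\mu_k^1(n_\#)\varepsilon_n,\qquad \mathbf E_1(f)=\sum_{n\in\mathbb Z}\overline{f(n_\#)}\mu_k^1(n_\#)\varepsilon_n,$$ $$\bar{\mathbf S}_1(f)=\sum_{n\in\mathbb Z} f(n_\#)\mu_k^1(n_\#)\overline{\varepsilon_n},\qquad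 \bar{\mathbf E}_1(f)=\sum_{n\in\mathbb Z}\overline{f(n_\#)}\mu_k^1(n_\#)\overline{\varepsilon_n}.$$ *)

theory Defs
  imports
    "HOL-Analysis.Infinite_Products"
    "HOL-Computational_Algebra.Computational_Algebra"
    "HOL-Library.Poly_Mapping"
begin

text \<open>
  The outer polynomial variable is \<open>q\<^bsup>1/2\<^esup>\<close>, the inner one is \<open>t\<^bsup>1/2\<^esup>\<close>.
\<close>
type_synonym K = "complex poly poly fract"

definition constK :: "complex \<Rightarrow> K" where
  "constK c = to_fract [:[:c:]:]"

definition qh :: K where "qh = to_fract [:0, 1:]"

definition th :: K where "th = to_fract [:[:0, 1:]:]"

definition is_barK :: "(K \<Rightarrow> K) \<Rightarrow> bool" where
  "is_barK \<phi> \<longleftrightarrow>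
     (\<forall>x y. \<phi> (x + y) = \<phi> x + \<phi> y) \<and> (\<forall>x y. \<phi> (x * y) = \<phi> x * \<phi> y) \<and>
     (\<forall>c. \<phi> (constK c) = constK c) \<and> \<phi> qh = inverse qh \<and> \<phi> th = inverse th"

definition barK :: "K \<Rightarrow> K" where
  "barK = (THE \<phi>. is_barK \<phi>)"

text \<open>Exponent-coefficient maps; multiplication is convolution.\<close>
type_synonym laurent = "int \<Rightarrow>\<^sub>0 K"

abbreviation Xpow :: "int \<Rightarrow> laurent" where
  "Xpow n \<equiv> Poly_Mapping.single n 1"

abbreviation scale :: "K \<Rightarrow> laurent \<Rightarrow> laurent" where
  "scale c f \<equiv> Poly_Mapping.single 0 c * f"

definition barP :: "laurent \<Rightarrow> laurent" where
  "barP f = (\<Sum>m\<in>Poly_Mapping.keys f. Poly_Mapping.single (- m) (barK (Poly_Mapping.lookup f m)))"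

definition evalP :: "laurent \<Rightarrow> K \<Rightarrow> K" where
  "evalP f z = (\<Sum>m\<in>Poly_Mapping.keys f. Poly_Mapping.lookup f m * z powi m)"

text \<open>
  The constant term of the product of a Laurent polynomial with a Laurent series
  \<open>\<Sum>\<^sub>i g i X\<^sup>i\<close>, which may be infinite in both directions.
\<close>
definition const_term :: "laurent \<Rightarrow> (int \<Rightarrow> K) \<Rightarrow> K" where
  "const_term f g = (\<Sum>m\<in>Poly_Mapping.keys f. Poly_Mapping.lookup f m * g (- m))"

text \<open>
  The function \<open>\<mu>\<^sub>k\<close> is a power series in \<open>q\<^bsup>1/2\<^esup>\<close> (outer variable) and \<open>t\<^bsup>1/2\<^esup>\<close>
  (inner variable) whose coefficients are Laurent polynomials in \<open>X\<close>.
  The infinite product converges in the topology of the outer power series ring.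
\<close>
type_synonym series_ring = "(int \<Rightarrow>\<^sub>0 complex) fps fps"

text \<open>
  The library inverse on power series needs an inverse on the coefficients,
  which Laurent polynomials do not have.
\<close>
definition unit_inv :: "'a::comm_monoid_mult \<Rightarrow> 'a" where
  "unit_inv a = (THE b. a * b = 1)"

definition qS :: series_ring where "qS = fps_X ^ 2"

definition tS :: series_ring where "tS = fps_const (fps_X ^ 2)"

definition XS :: "int \<Rightarrow> series_ring" where
  "XS m = fps_const (fps_const (Poly_Mapping.single m 1))"

definition mu :: series_ring where
  "mu = prodinf (\<lambda>j. (1 - qS ^ j * XS 2) * (1 - qS ^ (j + 1) * XS (-2)) *
           unit_inv ((1 - tS * qS ^ j * XS 2) * (1 - tS * qS ^ (j + 1) * XS (-2))))"

definition X_coeff :: "series_ring \<Rightarrow> int \<Rightarrow> complex fps fps" where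
  "X_coeff F n = Abs_fps (\<lambda>i. Abs_fps (\<lambda>j. Poly_Mapping.lookup (F $ i $ j) n))"

definition mu0_series :: "int \<Rightarrow> complex fps fps" where
  "mu0_series n = X_coeff mu n * unit_inv (X_coeff mu 0)"

definition expand :: "complex poly poly \<Rightarrow> complex fps fps" where
  "expand p = fps_of_poly (map_poly fps_of_poly p)"

text \<open>
  The coefficient of \<open>X\<^sup>n\<close> in \<open>\<mu>\<^sub>k\<^sup>0\<close>, as the element of \<open>K\<close> whose expansion in
  powers of \<open>q\<^bsup>1/2\<^esup>\<close>, \<open>t\<^bsup>1/2\<^esup>\<close> is the power series \<open>mu0_series n\<close>.
\<close>
definition mu0 :: "int \<Rightarrow> K" where
  "mu0 n = (THE r. \<exists>N D. D \<noteq> 0 \<and> r = Fract N D \<and> expand D * mu0_series n = expand N)"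

definition sgn_sharp :: "int \<Rightarrow> int" where
  "sgn_sharp n = (if n > 0 then 1 else - 1)"

text \<open>
  The point \<open>n\<^sub># = (n + sgn(n) k)/2\<close> is recorded by the value
  \<open>q\<^bsup>n/2\<^esup> t\<^bsup>sgn(n)/2\<^esup>\<close> of \<open>X = q\<^sup>x\<close> at \<open>x = n\<^sub>#\<close>;
  different \<open>n\<close> give different values. In particular \<open>sharp 0\<close> is the point \<open>-k/2\<close>.
\<close>
definition sharp :: "int \<Rightarrow> K" where
  "sharp n = qh powi n * th powi sgn_sharp n"

definition lower :: "int \<Rightarrow> int \<Rightarrow> bool" where
  "lower m n \<longleftrightarrow> \<bar>m\<bar> < \<bar>n\<bar> \<or> (m = - n \<and> - n > 0)"

definition is_e :: "int \<Rightarrow> laurent \<Rightarrow> bool" where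
  "is_e n e \<longleftrightarrow>
     (\<forall>m\<in>Poly_Mapping.keys (e - Xpow n). lower m n) \<and>
     (\<forall>m. lower m n \<longrightarrow> const_term (e * Xpow (- m)) mu0 = 0)"

definition e_poly :: "int \<Rightarrow> laurent" where
  "e_poly n = (THE e. is_e n e)"

definition eps :: "int \<Rightarrow> laurent" where
  "eps n = scale (inverse (evalP (e_poly n) (sharp 0))) (e_poly n)"

definition Zsharp :: "K set" where
  "Zsharp = range sharp"

text \<open>Functions on \<open>\<int>\<^sub>#\<close> are extended by zero to all of \<open>K\<close>.\<close>
definition Fspace :: "(K \<Rightarrow> K) set" where
  "Fspace = {f. finite {z. f z \<noteq> 0} \<and> {z. f z \<noteq> 0} \<subseteq> Zsharp}"

definition on_Zsharp :: "(int \<Rightarrow> K) \<Rightarrow> K \<Rightarrow> K" where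
  "on_Zsharp g z = (if z \<in> Zsharp then g (inv sharp z) else 0)"

definition mu1_pos :: "int \<Rightarrow> K" where
  "mu1_pos n = (th\<^sup>2) powi (- (n - 1)) *
     (\<Prod>j\<in>{1..n - 1}. (1 - (th\<^sup>2)\<^sup>2 * (qh\<^sup>2) powi j) / (1 - (qh\<^sup>2) powi j))"

definition mu1 :: "K \<Rightarrow> K" where
  "mu1 = on_Zsharp (\<lambda>n. mu1_pos (if n > 0 then n else 1 - n))"

definition S0 :: "laurent \<Rightarrow> K \<Rightarrow> K" where
  "S0 f = on_Zsharp (\<lambda>n. const_term (f * eps n) mu0)"

definition E0 :: "laurent \<Rightarrow> K \<Rightarrow> K" where
  "E0 f = on_Zsharp (\<lambda>n. const_term (barP f * eps n) mu0)"

definition S0_bar :: "laurent \<Rightarrow> K \<Rightarrow> K" where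
  "S0_bar f = on_Zsharp (\<lambda>n. const_term (f * barP (eps n)) mu0)"

definition E0_bar :: "laurent \<Rightarrow> K \<Rightarrow> K" where
  "E0_bar f = on_Zsharp (\<lambda>n. const_term (barP f * barP (eps n)) mu0)"

definition S1 :: "(K \<Rightarrow> K) \<Rightarrow> laurent" where
  "S1 f = (\<Sum>n | f (sharp n) \<noteq> 0. scale (f (sharp n) * mu1 (sharp n)) (eps n))"

definition E1 :: "(K \<Rightarrow> K) \<Rightarrow> laurent" where
  "E1 f = (\<Sum>n | f (sharp n) \<noteq> 0. scale (barK (f (sharp n)) * mu1 (sharp n)) (eps n))"

definition S1_bar :: "(K \<Rightarrow> K) \<Rightarrow> laurent" where
  "S1_bar f = (\<Sum>n | f (sharp n) \<noteq> 0. scale (f (sharp n) * mu1 (sharp n)) (barP (eps n)))"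

definition E1_bar :: "(K \<Rightarrow> K) \<Rightarrow> laurent" where
  "E1_bar f = (\<Sum>n | f (sharp n) \<noteq> 0. scale (barK (f (sharp n)) * mu1 (sharp n)) (barP (eps n)))"

end

theory Submission
  imports Defs
begin

text \<open>
  Put \<open>Y = X\<^sup>2\<close>. Up to a power of \<open>X\<close>, the polynomials \<open>e\<^sub>n\<close> are the monic orthogonal
  polynomials on the unit circle in the variable \<open>Y\<close> (for \<open>n > 0\<close>) or their reversals
  (for \<open>n \<le> 0\<close>), so they are produced by a Szego recursion. The product formula for
  \<open>\<mu>\<^sub>k\<close> gives a first-order recurrence for its moments, from which the recursion coefficients,
  all inner products of these polynomials with monomials, their norms and their values at
  \<open>-k/2\<close> follow in closed form by one induction. Hence \<open>\<epsilon>\<^sub>n\<close> and the conjugates of \<open>\<epsilon>\<^sub>n\<close> are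
  biorthogonal bases with norms \<open>1 / \<mu>\<^sub>k\<^sup>1(n\<^sub>#)\<close>; all eight identities are expansions in
  these bases.
\<close>

text \<open>Two reflections of the weight lie behind the moment recurrence. The whole product is
  invariant under X -> q^(1/2)/X, which ties the moment at -l to the one at l by the factor q^l; up
  to the factor (1 - Y)/(1 - tY) it is also invariant under X -> 1/X, which ties neighbouring
  moments. Both are proved on truncated products and read off coefficientwise. The recurrence places
  the moments in K, the only place where the bar acts, and shows that the bar exchanges the moments
  at l and -l. Thus the pairing of f and g given by the constant term of f bar(g) times the weight
  is Hermitian, so a triangular family orthogonal to lower monomials is fully orthogonal. The unit
  circle enters through the order on monomials: since the weight is even in X, only exponents of the
  parity of n matter, and those lower than n form an interval next to n in steps of 2, below n if n
  > 0 and above n otherwise. These are the orthogonality conditions of monic and of reversed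
  polynomials in Y. The point -k/2 is Y = 1/t, where both kinds of polynomials take the same
  value.\<close>

unbundle no vec_syntax

section \<open>The coefficients of the weight function\<close>

lemma unit_inv_eq:
  fixes a b :: "'a::comm_monoid_mult"
  assumes "a * b = 1"
  shows "unit_inv a = b"
  unfolding unit_inv_def
proof (rule the_equality)
  fix c assume "a * c = 1"
  then have "c = c * (a * b)" using assms by simp
  also have "\<dots> = b" using \<open>a * c = 1\<close> by (metis mult.assoc mult.commute mult_1)
  finally show "c = b" .
qed (fact assms)

lemma lookup_mult_sum:
  fixes f g :: "'b::ab_group_add \<Rightarrow>\<^sub>0 'a::comm_semiring_0"
  assumes "finite A" "Poly_Mapping.keys f \<subseteq> A"
  shows "Poly_Mapping.lookup (f * g) n = (\<Sum>k\<in>A. Poly_Mapping.lookup f k * Poly_Mapping.lookup g (n - k))"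
proof -
  have "(\<Sum>q. Poly_Mapping.lookup g q when n = l + q) = Poly_Mapping.lookup g (n - l)" for l
  proof -
    have "(n = l + q) = (q = n - l)" for q by (auto simp: algebra_simps)
    then show ?thesis by simp
  qed
  then have "Poly_Mapping.lookup (f * g) n = (\<Sum>l. Poly_Mapping.lookup f l * Poly_Mapping.lookup g (n - l))"
    by (simp add: lookup_mult)
  also have "\<dots> = (\<Sum>k\<in>A. Poly_Mapping.lookup f k * Poly_Mapping.lookup g (n - k))"
    using assms by (intro Sum_any.expand_superset) (force simp: in_keys_iff dest: mult_not_zero)+
  finally show ?thesis .
qed

text \<open>
  A series is admissible if it is a power series in \<open>X\<close> and \<open>q\<^bsup>1/2\<^esup> X\<^bsup>-1\<^esup>\<close>; then the substitution
  of \<open>q\<^bsup>1/2\<^esup> X\<^bsup>-1\<^esup>\<close> for \<open>X\<close>, which is undefined on the whole ring, makes sense, and the relation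
  \<open>swapped\<close> is its graph.
\<close>
definition admissible :: "series_ring \<Rightarrow> bool" where
  "admissible F \<longleftrightarrow> (\<forall>i j n. n < - int i \<longrightarrow> Poly_Mapping.lookup (F $ i $ j) n = 0)"

definition swapped :: "series_ring \<Rightarrow> series_ring \<Rightarrow> bool" where
  "swapped F G \<longleftrightarrow> admissible F \<and> admissible G \<and>
     (\<forall>a b j. Poly_Mapping.lookup (F $ b $ j) (int a - int b) = Poly_Mapping.lookup (G $ a $ j) (int b - int a))"

definition mirrored :: "series_ring \<Rightarrow> series_ring \<Rightarrow> bool" where
  "mirrored F G \<longleftrightarrow>
     (\<forall>i j n. Poly_Mapping.lookup (F $ i $ j) n = Poly_Mapping.lookup (G $ i $ j) (- n))"

definition even_in_X :: "series_ring \<Rightarrow> bool" where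
  "even_in_X F \<longleftrightarrow> (\<forall>i j n. odd n \<longrightarrow> Poly_Mapping.lookup (F $ i $ j) n = 0)"

lemma mult_coeff:
  fixes F G :: "'a::comm_ring_1 fps fps"
  shows "(F * G) $ i $ j = (\<Sum>i1=0..i. \<Sum>j1=0..j. F $ i1 $ j1 * G $ (i - i1) $ (j - j1))"
  by (simp add: fps_mult_nth fps_sum_nth)

lemma admissible_mult:
  assumes "admissible F" "admissible G"
  shows "admissible (F * G)"
  unfolding admissible_def
proof (intro allI impI)
  fix i j and n :: int assume n: "n < - int i"
  have "Poly_Mapping.lookup (F $ i1 $ j1 * G $ (i - i1) $ (j - j1)) n = 0" if "i1 \<le> i" for i1 j1
  proof -
    have "Poly_Mapping.lookup (F $ i1 $ j1) k * Poly_Mapping.lookup (G $ (i - i1) $ (j - j1)) (n - k) = 0" for k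
    proof (cases "k < - int i1")
      case True then show ?thesis using assms(1) by (simp add: admissible_def)
    next
      case False
      then have "n - k < - int (i - i1)" using n that by (simp add: of_nat_diff)
      then show ?thesis using assms(2) by (simp add: admissible_def)
    qed
    then show ?thesis
      unfolding lookup_mult_sum[OF finite_keys subset_refl] by (intro sum.neutral) blast
  qed
  then show "Poly_Mapping.lookup ((F * G) $ i $ j) n = 0"
    by (simp add: mult_coeff lookup_sum)
qed

text \<open>Written in X^a (q^(1/2)/X)^b the factors are ordinary power series, so the Laurent
  convolution collapses to a Cauchy product in a and b that treats the two exponents alike.\<close>

lemma admissible_mult_coeff:
  assumes "admissible F" "admissible G"
  shows "Poly_Mapping.lookup ((F * G) $ b $ j) (int a - int b) =
    (\<Sum>b1=0..b. \<Sum>j1=0..j. \<Sum>a1=0..a. Poly_Mapping.lookup (F $ b1 $ j1) (int a1 - int b1) *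
       Poly_Mapping.lookup (G $ (b - b1) $ (j - j1)) (int (a - a1) - int (b - b1)))"
proof -
  have "Poly_Mapping.lookup (F $ b1 $ j1 * G $ (b - b1) $ (j - j1)) (int a - int b) =
    (\<Sum>a1=0..a. Poly_Mapping.lookup (F $ b1 $ j1) (int a1 - int b1) *
       Poly_Mapping.lookup (G $ (b - b1) $ (j - j1)) (int (a - a1) - int (b - b1)))"
    if "b1 \<le> b" for b1 j1
  proof -
    let ?f = "F $ b1 $ j1" and ?g = "G $ (b - b1) $ (j - j1)"
    let ?I = "(\<lambda>a1. int a1 - int b1) ` {0..a}"
    let ?h = "\<lambda>k. Poly_Mapping.lookup ?f k * Poly_Mapping.lookup ?g (int a - int b - k)"
    \<comment> \<open>Below the range the first factor vanishes, above it the second.\<close>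
    have z: "?h k = 0" if "k \<notin> ?I" for k
    proof (cases "k < - int b1")
      case True then show ?thesis using assms(1) by (simp add: admissible_def)
    next
      case False
      have "k > int a - int b1"
      proof (rule ccontr)
        assume "\<not> ?thesis"
        with False have "k = int (nat (k + int b1)) - int b1" "nat (k + int b1) \<in> {0..a}" by auto
        then show False using that by blast
      qed
      then have "int a - int b - k < - int (b - b1)" using \<open>b1 \<le> b\<close> by (simp add: of_nat_diff)
      then show ?thesis using assms(2) by (simp add: admissible_def)
    qed
    have "Poly_Mapping.lookup (?f * ?g) (int a - int b) = sum ?h (Poly_Mapping.keys ?f \<union> ?I)"
      by (rule lookup_mult_sum) auto
    also have "\<dots> = sum ?h ?I"
      by (rule sum.mono_neutral_right) (use z in auto)
    also have "\<dots> = (\<Sum>a1=0..a. ?h (int a1 - int b1))"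
      by (subst sum.reindex) (auto simp: inj_on_def)
    also have "\<dots> = (\<Sum>a1=0..a. Poly_Mapping.lookup ?f (int a1 - int b1) *
       Poly_Mapping.lookup ?g (int (a - a1) - int (b - b1)))"
      using that by (intro sum.cong refl) (auto simp: of_nat_diff algebra_simps)
    finally show ?thesis .
  qed
  then show ?thesis by (simp add: mult_coeff lookup_sum)
qed

lemma swapped_mult:
  assumes "swapped F G" "swapped F' G'"
  shows "swapped (F * F') (G * G')"
proof -
  have ad: "admissible F" "admissible G" "admissible F'" "admissible G'"
    using assms by (auto simp: swapped_def)
  have "Poly_Mapping.lookup ((F * F') $ b $ j) (int a - int b) =
        Poly_Mapping.lookup ((G * G') $ a $ j) (int b - int a)" for a b j
  proof -
    have s: "Poly_Mapping.lookup (F $ b $ j) (int a - int b) = Poly_Mapping.lookup (G $ a $ j) (int b - int a)"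
         "Poly_Mapping.lookup (F' $ b $ j) (int a - int b) = Poly_Mapping.lookup (G' $ a $ j) (int b - int a)" for a b j
      using assms by (auto simp: swapped_def)
    have "Poly_Mapping.lookup ((F * F') $ b $ j) (int a - int b) =
      (\<Sum>b1=0..b. \<Sum>j1=0..j. \<Sum>a1=0..a. Poly_Mapping.lookup (G $ a1 $ j1) (int b1 - int a1) *
         Poly_Mapping.lookup (G' $ (a - a1) $ (j - j1)) (int (b - b1) - int (a - a1)))"
      by (simp only: admissible_mult_coeff[OF ad(1,3)] s)
    also have "\<dots> = (\<Sum>j1=0..j. \<Sum>b1=0..b. \<Sum>a1=0..a. Poly_Mapping.lookup (G $ a1 $ j1) (int b1 - int a1) *
         Poly_Mapping.lookup (G' $ (a - a1) $ (j - j1)) (int (b - b1) - int (a - a1)))"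
      by (rule sum.swap)
    also have "\<dots> = (\<Sum>j1=0..j. \<Sum>a1=0..a. \<Sum>b1=0..b. Poly_Mapping.lookup (G $ a1 $ j1) (int b1 - int a1) *
         Poly_Mapping.lookup (G' $ (a - a1) $ (j - j1)) (int (b - b1) - int (a - a1)))"
      by (rule sum.cong[OF refl sum.swap])
    also have "\<dots> = (\<Sum>a1=0..a. \<Sum>j1=0..j. \<Sum>b1=0..b. Poly_Mapping.lookup (G $ a1 $ j1) (int b1 - int a1) *
         Poly_Mapping.lookup (G' $ (a - a1) $ (j - j1)) (int (b - b1) - int (a - a1)))"
      by (rule sum.swap)
    also have "\<dots> = Poly_Mapping.lookup ((G * G') $ a $ j) (int b - int a)"
      by (simp only: admissible_mult_coeff[OF ad(2,4)])
    finally show ?thesis .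
  qed
  then show ?thesis using ad by (simp add: swapped_def admissible_mult)
qed

lemma swapped_diff:
  "swapped F G \<Longrightarrow> swapped F' G' \<Longrightarrow> swapped (F - F') (G - G')"
  by (simp add: swapped_def admissible_def lookup_minus)

lemma swapped_sym: "swapped F G \<Longrightarrow> swapped G F"
  by (auto simp: swapped_def)

lemma mirrored_mult:
  assumes "mirrored F G" "mirrored F' G'"
  shows "mirrored (F * F') (G * G')"
  unfolding mirrored_def
proof (intro allI)
  fix i j and n :: int
  have "Poly_Mapping.lookup (F $ i1 $ j1 * F' $ (i - i1) $ (j - j1)) n =
        Poly_Mapping.lookup (G $ i1 $ j1 * G' $ (i - i1) $ (j - j1)) (- n)" for i1 j1
  proof -
    let ?A = "Poly_Mapping.keys (F $ i1 $ j1)"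
    have m: "Poly_Mapping.lookup (F $ i1 $ j1) k = Poly_Mapping.lookup (G $ i1 $ j1) (- k)"
        "Poly_Mapping.lookup (F' $ i1 $ j1) k = Poly_Mapping.lookup (G' $ i1 $ j1) (- k)" for i1 j1 k
      using assms by (auto simp: mirrored_def)
    have k: "Poly_Mapping.keys (G $ i1 $ j1) \<subseteq> uminus ` ?A"
    proof
      fix x assume "x \<in> Poly_Mapping.keys (G $ i1 $ j1)"
      then have "- x \<in> ?A" by (simp add: in_keys_iff m)
      then show "x \<in> uminus ` ?A" by force
    qed
    have "Poly_Mapping.lookup (G $ i1 $ j1 * G' $ (i - i1) $ (j - j1)) (- n) =
      (\<Sum>k\<in>uminus ` ?A. Poly_Mapping.lookup (G $ i1 $ j1) k * Poly_Mapping.lookup (G' $ (i - i1) $ (j - j1)) (- n - k))"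
      by (rule lookup_mult_sum) (use k in auto)
    also have "\<dots> = (\<Sum>k\<in>?A. Poly_Mapping.lookup (G $ i1 $ j1) (- k) * Poly_Mapping.lookup (G' $ (i - i1) $ (j - j1)) (- n - (- k)))"
      by (subst sum.reindex) (auto simp: inj_on_def)
    also have "\<dots> = (\<Sum>k\<in>?A. Poly_Mapping.lookup (F $ i1 $ j1) k * Poly_Mapping.lookup (F' $ (i - i1) $ (j - j1)) (n - k))"
      by (simp add: m)
    also have "\<dots> = Poly_Mapping.lookup (F $ i1 $ j1 * F' $ (i - i1) $ (j - j1)) n"
      by (rule lookup_mult_sum[symmetric]) auto
    finally show ?thesis ..
  qed
  then show "Poly_Mapping.lookup ((F * F') $ i $ j) n = Poly_Mapping.lookup ((G * G') $ i $ j) (- n)"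
    by (simp add: mult_coeff lookup_sum)
qed

lemma mirrored_diff:
  "mirrored F G \<Longrightarrow> mirrored F' G' \<Longrightarrow> mirrored (F - F') (G - G')"
  by (simp add: mirrored_def lookup_minus)

lemma even_in_X_mult:
  assumes "even_in_X F" "even_in_X G"
  shows "even_in_X (F * G)"
  unfolding even_in_X_def
proof (intro allI impI)
  fix i j and n :: int assume n: "odd n"
  have "Poly_Mapping.lookup (F $ i1 $ j1 * G $ (i - i1) $ (j - j1)) n = 0" for i1 j1
  proof -
    have "Poly_Mapping.lookup (F $ i1 $ j1) k * Poly_Mapping.lookup (G $ (i - i1) $ (j - j1)) (n - k) = 0" for k
      using assms n by (cases "odd k") (auto simp: even_in_X_def)
    then show ?thesis
      unfolding lookup_mult_sum[OF finite_keys subset_refl] by (intro sum.neutral) blast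
  qed
  then show "Poly_Mapping.lookup ((F * G) $ i $ j) n = 0"
    by (simp add: mult_coeff lookup_sum)
qed

lemma even_in_X_diff: "even_in_X F \<Longrightarrow> even_in_X G \<Longrightarrow> even_in_X (F - G)"
  by (simp add: even_in_X_def lookup_minus)

section \<open>The factors of the product as power series\<close>

lemma qS_power: "qS ^ c = fps_X ^ (2 * c)"
  by (simp only: qS_def power_mult)

lemma lookup_monomial_coeff:
  "Poly_Mapping.lookup ((qS ^ c * XS e) $ i $ j) n = (if i = 2 * c \<and> j = 0 \<and> n = e then 1 else 0)"
  by (auto simp: qS_def XS_def lookup_single power_mult[symmetric] fps_X_power_mult_nth when_def
      intro: ccontr split: if_splits)

text \<open>The geometric series of t q^c X^e. In the exponents i, j of q^(1/2) and t^(1/2) its m-th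
  term has j = 2m and i = 2cm = cj.\<close>

definition geom :: "nat \<Rightarrow> int \<Rightarrow> series_ring" where
  "geom c e = Abs_fps (\<lambda>i. Abs_fps (\<lambda>j.
     if even j \<and> i = c * j then Poly_Mapping.single (e * int (j div 2)) 1 else 0))"

lemma lookup_geom_coeff:
  "Poly_Mapping.lookup (geom c e $ i $ j) n =
     (if even j \<and> i = c * j \<and> n = e * int (j div 2) then 1 else 0)"
  by (auto simp: geom_def lookup_single when_def)

lemma geom_inverse: "(1 - tS * qS ^ c * XS e) * geom c e = 1"
proof -
  have "(tS * qS ^ c * XS e) * geom c e = geom c e - 1"
  proof (intro fps_ext)
    fix i j
    have E: "(tS * qS ^ c * XS e) * geom c e =
        fps_const (fps_X ^ 2) * (fps_const (fps_const (Poly_Mapping.single e 1)) * (fps_X ^ (2 * c) * geom c e))"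
      by (simp only: tS_def qS_power XS_def ac_simps)
    have eq: "((tS * qS ^ c * XS e) * geom c e) $ i $ j =
        (if i < 2 * c \<or> j < 2 then 0 else Poly_Mapping.single e 1 * geom c e $ (i - 2 * c) $ (j - 2))"
      unfolding E by (simp add: fps_X_power_mult_nth)
    show "((tS * qS ^ c * XS e) * geom c e) $ i $ j = (geom c e - 1) $ i $ j"
    proof (cases "j < 2")
      case True
      then have "j = 0 \<or> j = 1" by auto
      then show ?thesis unfolding eq by (auto simp: geom_def)
    next
      case False
      define k where "k = j - 2"
      then have j: "j = k + 2" using False by simp
      show ?thesis
      proof (cases "i < 2 * c")
        case True then show ?thesis unfolding eq using j by (auto simp: geom_def)
      next
        case False
        define m where "m = i - 2 * c"
        then have "i = m + 2 * c" using False by simp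
        then show ?thesis unfolding eq using j by (auto simp: geom_def mult_single algebra_simps)
      qed
    qed
  qed
  then show ?thesis by (simp add: left_diff_distrib)
qed

definition qfactor :: "nat \<Rightarrow> int \<Rightarrow> series_ring" where
  "qfactor c e = (1 - qS ^ c * XS e) * geom c e"

text \<open>Being the product of the two exchanged variables X and q^(1/2)/X, q^(1/2) is fixed,
  while X^2 goes to q X^(-2). So the two kinds of factors of the weight are exchanged at the same
  j.\<close>

lemma swapped_qfactor: "swapped (qfactor c 2) (qfactor (c + 1) (- 2))"
proof -
  have "swapped 1 1"
    by (auto simp: swapped_def admissible_def lookup_one when_def)
  moreover have "swapped (qS ^ c * XS 2) (qS ^ (c + 1) * XS (- 2))"
    unfolding swapped_def admissible_def lookup_monomial_coeff by auto
  moreover have "swapped (geom c 2) (geom (c + 1) (- 2))"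
  proof -
    have eq: "(even j \<and> b = c * j \<and> int a - int b = 2 * int (j div 2)) =
          (even j \<and> a = (c + 1) * j \<and> int b - int a = - 2 * int (j div 2))" for a b j
      by (cases "even j") (auto elim!: evenE simp: algebra_simps simp flip: of_nat_add of_nat_mult)
    have "\<not> 2 * int (j div 2) < - int i" for i j
      by simp
    moreover have "\<not> - (2 * int (j div 2)) < - int j - int c * int j" for j
    proof -
      have "2 * int (j div 2) \<le> int j" by simp
      also have "int j \<le> int j + int c * int j" by simp
      finally show ?thesis by linarith
    qed
    ultimately show ?thesis
      unfolding swapped_def admissible_def lookup_geom_coeff eq by auto
  qed
  ultimately show ?thesis
    unfolding qfactor_def by (rule swapped_mult[OF swapped_diff])
qed

lemma mirrored_qfactor: "mirrored (qfactor c e) (qfactor c (- e))"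
proof -
  have "mirrored 1 1"
    by (auto simp: mirrored_def lookup_one when_def)
  moreover have "mirrored (qS ^ c * XS e) (qS ^ c * XS (- e))"
    unfolding mirrored_def lookup_monomial_coeff by auto
  moreover have "mirrored (geom c e) (geom c (- e))"
    unfolding mirrored_def lookup_geom_coeff by auto
  ultimately show ?thesis
    unfolding qfactor_def by (rule mirrored_mult[OF mirrored_diff])
qed

lemma even_in_X_qfactor: "even e \<Longrightarrow> even_in_X (qfactor c e)"
proof -
  assume "even e"
  then have "even_in_X 1" "even_in_X (qS ^ c * XS e)" "even_in_X (geom c e)"
    unfolding even_in_X_def lookup_monomial_coeff lookup_geom_coeff by (auto simp: lookup_one when_def)
  then show ?thesis
    unfolding qfactor_def by (rule even_in_X_mult[OF even_in_X_diff])
qed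

lemma qfactor_nth:
  assumes "i < 2 * c"
  shows "qfactor c e $ i = (if i = 0 then 1 else 0)"
proof -
  have "geom c e $ i = (if i = 0 then 1 else 0)"
    using assms by (auto simp: geom_def fps_eq_iff elim!: evenE)
  moreover have "qfactor c e = geom c e - XS e * (fps_X ^ (2 * c) * geom c e)"
    unfolding qfactor_def qS_power left_diff_distrib by (simp only: mult_1 ac_simps)
  moreover have "(XS e * (fps_X ^ (2 * c) * geom c e)) $ i = 0"
    using assms by (simp add: XS_def fps_X_power_mult_nth)
  ultimately show ?thesis by simp
qed

lemma fps_mult_one_mod_nth:
  fixes F H :: "'a::comm_ring_1 fps"
  assumes "\<And>i. i < M \<Longrightarrow> H $ i = (if i = 0 then 1 else 0)" "i < M"
  shows "(F * H) $ i = F $ i"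
proof -
  have "(F * H) $ i = (\<Sum>k=0..i. if k = i then F $ i else 0)"
    unfolding fps_mult_nth using assms by (intro sum.cong) auto
  then show ?thesis by simp
qed

section \<open>Truncated products and their limit\<close>

definition partial_mu :: "nat \<Rightarrow> series_ring" where
  "partial_mu N = (\<Prod>j<N. qfactor j 2 * qfactor (j + 1) (- 2))"

definition partial_sym :: "nat \<Rightarrow> series_ring" where
  "partial_sym N = (\<Prod>j<N. qfactor (j + 1) 2 * qfactor (j + 1) (- 2))"

text \<open>
  Apart from the factor \<open>(1 - Y) / (1 - t Y)\<close>, the weight is invariant under \<open>X \<mapsto> X\<^bsup>-1\<^esup>\<close>; the leftover
  factor \<open>qfactor N 2\<close> of the truncated product tends to 1.
\<close>
lemma partial_mu_sym:
  "(1 - tS * XS 2) * (partial_mu N * qfactor N 2) = (1 - XS 2) * partial_sym N"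
proof (induction N)
  case 0
  have "(1 - tS * XS 2) * geom 0 2 = 1" using geom_inverse[of 0 2] by simp
  then have "(1 - tS * XS 2) * ((1 - XS 2) * geom 0 2) = 1 - XS 2"
    by (metis mult.left_commute mult.right_neutral)
  then show ?case
    by (simp add: partial_mu_def partial_sym_def qfactor_def)
next
  case (Suc N)
  have "(1 - tS * XS 2) * (partial_mu (Suc N) * qfactor (Suc N) 2) =
     ((1 - tS * XS 2) * (partial_mu N * qfactor N 2)) * (qfactor (Suc N) 2 * qfactor (Suc N) (- 2))"
    by (simp add: partial_mu_def ac_simps)
  also have "\<dots> = (1 - XS 2) * partial_sym (Suc N)"
    unfolding Suc by (simp add: partial_sym_def ac_simps)
  finally show ?case .
qed

lemma swapped_partial_mu: "swapped (partial_mu N) (partial_mu N)"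
proof (induction N)
  case 0
  show ?case
    by (auto simp: partial_mu_def swapped_def admissible_def lookup_one when_def)
next
  case (Suc N)
  have "swapped (qfactor N 2 * qfactor (N + 1) (- 2)) (qfactor (N + 1) (- 2) * qfactor N 2)"
    by (intro swapped_mult swapped_qfactor swapped_sym[OF swapped_qfactor])
  then show ?case
    using swapped_mult[OF Suc] by (simp add: partial_mu_def mult.commute)
qed

lemma even_in_X_partial_mu: "even_in_X (partial_mu N)"
proof (induction N)
  case 0
  show ?case by (auto simp: partial_mu_def even_in_X_def lookup_one when_def)
next
  case (Suc N)
  then show ?case by (auto simp: partial_mu_def intro!: even_in_X_mult even_in_X_qfactor)
qed

lemma mirrored_partial_sym: "mirrored (partial_sym N) (partial_sym N)"
proof (induction N)
  case 0
  show ?case by (auto simp: partial_sym_def mirrored_def lookup_one when_def)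
next
  case (Suc N)
  have "mirrored (qfactor (N + 1) 2 * qfactor (N + 1) (- 2)) (qfactor (N + 1) (- 2) * qfactor (N + 1) 2)"
    using mirrored_mult[OF mirrored_qfactor[of "N+1" 2] mirrored_qfactor[of "N+1" "-2"]] by simp
  then show ?case
    using mirrored_mult[OF Suc] by (simp add: partial_sym_def mult.commute)
qed

lemma partial_mu_stable:
  assumes "i < 2 * N" "N \<le> M"
  shows "partial_mu M $ i = partial_mu N $ i"
  using assms(2)
proof (induction M rule: dec_induct)
  case (step M)
  have "partial_mu (Suc M) = partial_mu M * qfactor M 2 * qfactor (Suc M) (- 2)"
    by (simp add: partial_mu_def ac_simps)
  then have "partial_mu (Suc M) $ i = (partial_mu M * qfactor M 2) $ i"
    using assms step by (simp only:) (intro fps_mult_one_mod_nth[OF qfactor_nth], auto)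
  also have "\<dots> = partial_mu M $ i"
    using assms step by (intro fps_mult_one_mod_nth[OF qfactor_nth]) auto
  finally show ?case using step by simp
qed simp

text \<open>All factors beyond the truncation are 1 modulo q^N; the outer variable is q^(1/2), hence
  the bound \<open>2 * N\<close>.\<close>

lemma mu_nth:
  assumes "i < 2 * N"
  shows "mu $ i = partial_mu N $ i"
proof -
  let ?f = "\<lambda>j. (1 - qS ^ j * XS 2) * (1 - qS ^ (j + 1) * XS (-2)) *
           unit_inv ((1 - tS * qS ^ j * XS 2) * (1 - tS * qS ^ (j + 1) * XS (-2)))"
  have f: "?f j = qfactor j 2 * qfactor (j + 1) (- 2)" for j
  proof -
    have "unit_inv ((1 - tS * qS ^ j * XS 2) * (1 - tS * qS ^ (j + 1) * XS (-2))) = geom j 2 * geom (j + 1) (- 2)"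
      using geom_inverse[of j 2] geom_inverse[of "j + 1" "- 2"]
      by (intro unit_inv_eq) (metis (no_types, lifting) mult.assoc mult.left_commute mult_1)
    then show ?thesis by (simp add: qfactor_def ac_simps)
  qed
  define m where "m = Abs_fps (\<lambda>i. partial_mu (Suc i) $ i)"
  have m: "m $ i = partial_mu N $ i" if "i < N" for i N
    unfolding m_def using partial_mu_stable[of i "Suc i" N] that by simp
  have "(\<lambda>n. \<Prod>j\<le>n. ?f (j + 0)) \<longlonglongrightarrow> m"
  proof (rule tendsto_fpsI)
    fix n
    show "\<forall>\<^sub>F x in sequentially. (\<Prod>j\<le>x. ?f (j + 0)) $ n = m $ n"
      using eventually_ge_at_top[of n]
    proof eventually_elim
      case (elim x)
      have "(\<Prod>j\<le>x. ?f (j + 0)) = partial_mu (Suc x)"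
        unfolding partial_mu_def f by (simp add: lessThan_Suc_atMost)
      then show ?case using m[of n "Suc x"] elim by simp
    qed
  qed
  \<comment> \<open>\<open>has_prod\<close> demands a nonzero limit. The lowest coefficient is that
    of the first truncation, 1 - X^2.\<close>
  moreover have "m \<noteq> 0"
  proof -
    have "partial_mu 1 $ 0 $ 0 = 1 - Poly_Mapping.single 2 1"
      by (simp add: partial_mu_def qfactor_def qS_def XS_def geom_def)
    moreover have "(1 :: int \<Rightarrow>\<^sub>0 complex) \<noteq> Poly_Mapping.single 2 1"
      by (metis lookup_one_zero lookup_single_not_eq zero_neq_one zero_neq_numeral)
    ultimately have "m $ 0 $ 0 \<noteq> 0" using m[of 0 1] by simp
    then show ?thesis by auto
  qed
  ultimately have "?f has_prod m"
    by (simp add: has_prod_def raw_has_prod_def)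
  then have "mu = m"
    unfolding mu_def by (rule has_prod_unique[symmetric])
  then show ?thesis
    using m[of i "Suc i + N"] partial_mu_stable[of i N "Suc i + N"] assms by simp
qed

section \<open>Recurrence for the coefficients of the weight\<close>

lemma X_coeff_nth [simp]: "X_coeff F n $ i $ j = Poly_Mapping.lookup (F $ i $ j) n"
  by (simp add: X_coeff_def)

lemma lookup_single_mult:
  fixes f :: "int \<Rightarrow>\<^sub>0 'a::comm_ring_1"
  shows "Poly_Mapping.lookup (Poly_Mapping.single m c * f) n = c * Poly_Mapping.lookup f (n - m)"
  by (subst lookup_mult_sum[of "{m}"]) auto

lemma mu_coeff_odd: "odd n \<Longrightarrow> X_coeff mu n = 0"
  using even_in_X_partial_mu unfolding even_in_X_def
  by (intro fps_ext) (metis X_coeff_nth fps_zero_nth lessI mu_nth mult_2 trans_less_add1)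

text \<open>The substitution X -> q^(1/2)/X sends X^n to q^(n/2) X^(-n) and fixes the product. As
  \<open>fps_X\<close> stands for q^(1/2), its exponent is n.\<close>

lemma mu_coeff_neg:
  assumes "n \<ge> 0"
  shows "X_coeff mu (- n) = fps_X ^ nat n * X_coeff mu n"
proof (intro fps_ext)
  fix i j
  let ?P = "partial_mu (Suc i)"
  have sw: "swapped ?P ?P" by (rule swapped_partial_mu)
  have m: "mu $ k = ?P $ k" if "k \<le> i" for k
    using that by (intro mu_nth) auto
  show "X_coeff mu (- n) $ i $ j = (fps_X ^ nat n * X_coeff mu n) $ i $ j"
  proof (cases "i < nat n")
    case True
    then have "- n < - int i" by simp
    then have "Poly_Mapping.lookup (?P $ i $ j) (- n) = 0"
      using sw by (simp add: swapped_def admissible_def)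
    then show ?thesis using True by (simp add: fps_X_power_mult_nth m)
  next
    case False
    \<comment> \<open>In the exponents a of X and b of q^(1/2)/X the monomial has a = i - n and b =
      i; the swap exchanges them.\<close>
    have "int (i - nat n) - int i = - n" "int i - int (i - nat n) = n" using assms False by auto
    then have "Poly_Mapping.lookup (?P $ i $ j) (- n) = Poly_Mapping.lookup (?P $ (i - nat n) $ j) n"
      using sw unfolding swapped_def by metis
    then show ?thesis using False by (simp add: fps_X_power_mult_nth m)
  qed
qed

lemma X_coeff_one_minus_mult:
  "X_coeff ((1 - XS 2) * F) n = X_coeff F n - X_coeff F (n - 2)"
  "X_coeff ((1 - tS * XS 2) * F) n = X_coeff F n - fps_const (fps_X ^ 2) * X_coeff F (n - 2)"
proof -
  have "X_coeff (XS 2 * F) n = X_coeff F (n - 2)" for F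
    by (intro fps_ext) (simp add: XS_def lookup_single_mult)
  moreover have "X_coeff (tS * F) n = fps_const (fps_X ^ 2) * X_coeff F n" for F n
    by (intro fps_ext) (simp add: tS_def fps_X_power_mult_nth)
  moreover have "X_coeff (F - G) n = X_coeff F n - X_coeff G n" for F G
    by (intro fps_ext) (simp add: lookup_minus)
  ultimately show "X_coeff ((1 - XS 2) * F) n = X_coeff F n - X_coeff F (n - 2)"
     "X_coeff ((1 - tS * XS 2) * F) n = X_coeff F n - fps_const (fps_X ^ 2) * X_coeff F (n - 2)"
    by (simp_all add: left_diff_distrib mult.assoc)
qed

text \<open>Coefficients of X^n and X^(2-n) are compared in (1 - tY) mu = (1 - Y) s, truncated
  modulo a power of q. As s is symmetric under X -> 1/X, the right-hand sides s_n - s_(n-2) and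
  s_(2-n) - s_(-n) cancel.\<close>

lemma mu_coeff_balance:
  defines "T \<equiv> fps_const (fps_X ^ 2) :: complex fps fps"
  shows "X_coeff mu n - T * X_coeff mu (n - 2) + X_coeff mu (2 - n) - T * X_coeff mu (- n) = 0"
proof (rule fps_ext)
  fix i
  let ?N = "Suc i"
  let ?S = "X_coeff (partial_sym ?N)"
  have "X_coeff mu k $ i = X_coeff (partial_mu ?N * qfactor ?N 2) k $ i" for k
    by (intro fps_ext) (simp add: mu_nth[of i ?N] fps_mult_one_mod_nth[OF qfactor_nth])
  then have c: "(X_coeff mu k - T * X_coeff mu (k - 2)) $ i = (?S k - ?S (k - 2)) $ i" for k
    using arg_cong[OF partial_mu_sym[of ?N], of "\<lambda>F. X_coeff F k $ i"]
    by (simp add: X_coeff_one_minus_mult T_def)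
  have s: "?S k = ?S (- k)" for k
    using mirrored_partial_sym by (intro fps_ext) (simp add: mirrored_def)
  have "(X_coeff mu n - T * X_coeff mu (n - 2)) $ i + (X_coeff mu (2 - n) - T * X_coeff mu (- n)) $ i = 0"
    using c[of n] c[of "2 - n"] s[of n] s[of "n - 2"] by simp
  then show "(X_coeff mu n - T * X_coeff mu (n - 2) + X_coeff mu (2 - n) - T * X_coeff mu (- n)) $ i = 0 $ i"
    by (simp add: algebra_simps)
qed

text \<open>Eliminating the nonpositive indices by \<open>mu_coeff_neg\<close> turns the four-term
  relation into a first-order one.\<close>

lemma mu_coeff_rec:
  assumes "n \<ge> 2"
  shows "(1 - fps_const (fps_X ^ 2) * fps_X ^ nat n) * X_coeff mu n =
         (fps_const (fps_X ^ 2) - fps_X ^ nat (n - 2)) * X_coeff mu (n - 2)"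
  using mu_coeff_balance[of n] mu_coeff_neg[of n] mu_coeff_neg[of "n - 2"] assms
  by (simp add: algebra_simps)

text \<open>The lowest coefficient, in q and then in t, is the constant term 1 of 1 - X^2, so the
  series is invertible at both levels.\<close>

lemma mu_const_unit: "X_coeff mu 0 * unit_inv (X_coeff mu 0) = 1"
proof -
  have "partial_mu 1 $ 0 $ 0 = 1 - Poly_Mapping.single 2 1"
    by (simp add: partial_mu_def qfactor_def qS_def XS_def geom_def)
  then have "X_coeff mu 0 $ 0 $ 0 = 1"
    by (simp add: mu_nth[of 0 1] lookup_minus lookup_single)
  then have "X_coeff mu 0 $ 0 * inverse (X_coeff mu 0 $ 0) = 1"
    by (intro inverse_mult_eq_1') simp
  from fps_right_inverse[OF this] show ?thesis
    by (metis unit_inv_eq)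
qed

section \<open>The moments as rational functions and the bar involution\<close>

lemma to_fract_power: "to_fract (x ^ n) = to_fract x ^ n"
  by (induction n) simp_all

lemma monomial_K: "constK c * (qh ^ i * th ^ j) = to_fract (monom (monom c j) i)"
proof -
  have "monom (monom c j) i = [:[:c:]:] * ([:0, 1:] ^ i * [:[:0, 1:]:] ^ j)"
    by (simp add: monom_altdef poly_const_pow)
  then show ?thesis
    by (simp only: constK_def qh_def th_def to_fract_power to_fract_mult)
qed

lemma to_fract_monom: "to_fract (monom (monom 1 j) i) = qh ^ i * th ^ j" "to_fract (monom 1 i) = qh ^ i"
  using monomial_K[of 1 i j] monomial_K[of 1 i 0] by (simp_all add: constK_def flip: one_pCons)

lemma constK_1 [simp]: "constK 1 = 1" and constK_0 [simp]: "constK 0 = 0"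
  by (simp_all add: constK_def flip: one_pCons)

lemma qh_nonzero [simp]: "qh \<noteq> 0" and th_nonzero [simp]: "th \<noteq> 0"
  by (simp_all add: qh_def th_def)

text \<open>Source of the nonvanishing of 1 - q^l for nonzero l, of 1 - t q^l and 1 - t^2 q^l for
  all l, and of the injectivity of \<open>sharp\<close>. Clearing negative exponents reduces it to
  comparing two monomials.\<close>

lemma qh_th_powi_eq_1_iff: "qh powi m * th powi n = 1 \<longleftrightarrow> m = 0 \<and> n = 0"
proof
  assume eq: "qh powi m * th powi n = 1"
  have e: "z powi k * z ^ nat (- k) = z ^ nat k" if "z \<noteq> 0" for z :: K and k
    using that by (cases "k \<ge> 0") (auto simp: power_int_def field_simps)
  have "qh ^ nat m * th ^ nat n = (qh powi m * th powi n) * (qh ^ nat (- m) * th ^ nat (- n))"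
    using e[of qh m] e[of th n] by (simp add: ac_simps)
  then have "to_fract (monom (monom 1 (nat n)) (nat m)) = to_fract (monom (monom (1::complex) (nat (- n))) (nat (- m)))"
    using eq by (simp flip: monomial_K)
  then have "monom (monom (1::complex) (nat n)) (nat m) = monom (monom 1 (nat (- n))) (nat (- m))"
    by simp
  then have "nat m = nat (- m) \<and> nat n = nat (- n)"
    by (metis coeff_monom degree_monom_eq monom_eq_0_iff one_neq_zero)
  then show "m = 0 \<and> n = 0" by auto
qed simp

section \<open>Rational functions and their power series expansions\<close>

lemma expand_nth [simp]: "expand p $ i = fps_of_poly (coeff p i)"
  by (simp add: expand_def coeff_map_poly)

lemma expand_mult: "expand (p * r) = expand p * expand r"
  by (rule fps_ext) (simp add: fps_mult_nth coeff_mult fps_of_poly_sum fps_of_poly_mult atLeast0AtMost)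

lemma expand_diff: "expand (p - r) = expand p - expand r"
  by (rule fps_ext) (simp add: fps_of_poly_diff)

lemma expand_monom: "expand (monom c n) = fps_const (fps_of_poly c) * fps_X ^ n"
  by (rule fps_ext) simp

lemma expand_0 [simp]: "expand 0 = 0" and expand_1 [simp]: "expand 1 = 1"
  by (rule fps_ext; simp)+

lemma expand_eq_iff [simp]: "expand p = expand r \<longleftrightarrow> p = r"
proof
  assume "expand p = expand r"
  then have "fps_of_poly (coeff p i) = fps_of_poly (coeff r i)" for i
    by (metis expand_nth)
  then show "p = r" by (simp add: fps_of_poly_eq_iff poly_eq_iff)
qed simp

text \<open>Stated with the denominator cleared, since a denominator need not be invertible as a
  power series; injectivity of \<open>expand\<close> still determines the fraction.\<close>

definition represents :: "K \<Rightarrow> complex fps fps \<Rightarrow> bool" where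
  "represents r s \<longleftrightarrow> (\<exists>N D. D \<noteq> 0 \<and> r = Fract N D \<and> expand D * s = expand N)"

lemma represents_unique:
  assumes "represents r s" "represents r' s"
  shows "r = r'"
proof -
  obtain N D N' D' where D: "D \<noteq> 0" "r = Fract N D" "expand D * s = expand N"
     "D' \<noteq> 0" "r' = Fract N' D'" "expand D' * s = expand N'"
    using assms by (auto simp: represents_def)
  have "expand (N * D') = expand (N' * D)"
    unfolding expand_mult D(3)[symmetric] D(6)[symmetric] by (simp add: ac_simps)
  then show ?thesis using D by (simp add: eq_fract)
qed

lemma represents_0: "represents 0 0" and represents_1: "represents 1 1"
  unfolding represents_def Zero_fract_def One_fract_def
  by (rule exI[of _ 0], rule exI[of _ 1], simp) (rule exI[of _ 1], rule exI[of _ 1], simp)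

lemma mu0_eqI: "represents r (mu0_series n) \<Longrightarrow> mu0 n = r"
  unfolding mu0_def using represents_unique[unfolded represents_def]
  by (intro the_equality) (auto simp: represents_def)

lemma represents_step:
  assumes "represents r s" "expand P * s' = expand R * s" "P \<noteq> 0"
  shows "represents (to_fract R / to_fract P * r) s'"
proof -
  obtain N D where D: "D \<noteq> 0" "r = Fract N D" "expand D * s = expand N"
    using assms(1) by (auto simp: represents_def)
  have "expand (P * D) * s' = expand D * (expand P * s')"
    by (simp add: expand_mult ac_simps)
  also have "\<dots> = expand (R * N)"
    unfolding assms(2) expand_mult D(3)[symmetric] by (simp add: ac_simps)
  finally show ?thesis
    using D assms(3) unfolding represents_def
    by (intro exI[of _ "R * N"] exI[of _ "P * D"]) (simp flip: Fract_conv_to_fract)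
qed

section \<open>The moments as elements of K\<close>

abbreviation qK :: K where "qK \<equiv> qh\<^sup>2"
abbreviation tK :: K where "tK \<equiv> th\<^sup>2"

definition moment :: "int \<Rightarrow> K" where "moment l = mu0 (2 * l)"

lemma mu0_odd: "odd n \<Longrightarrow> mu0 n = 0"
  by (intro mu0_eqI) (simp add: represents_0 mu0_series_def mu_coeff_odd)

text \<open>\<open>mu0\<close> is a definite description, so a moment can be computed only once some
  fraction is known to represent its series. Rationality and recurrence are therefore obtained
  together, starting from the normalised constant term 1.\<close>

lemma represents_moment: "represents (moment (int k)) (mu0_series (2 * int k))"
  and moment_Suc: "moment (int k + 1) * (1 - tK * qK ^ (k + 1)) = (tK - qK ^ k) * moment (int k)"
  and moment_0: "moment 0 = 1"
proof -
  define P :: "nat \<Rightarrow> complex poly poly" where "P k = 1 - monom (monom 1 2) (2 * (k + 1))" for k :: nat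
  define R :: "nat \<Rightarrow> complex poly poly" where "R k = monom (monom 1 2) 0 - monom 1 (2 * k)" for k :: nat
  have PR: "to_fract (P k) = 1 - tK * qK ^ (k + 1)" "to_fract (R k) = tK - qK ^ k" for k
    unfolding P_def R_def to_fract_diff to_fract_monom power_mult
    by (simp_all only: to_fract_1 power_0 mult_1 mult.commute)
  have "P k \<noteq> 0" for k
  proof -
    have "coeff (P k) 0 \<noteq> 0" by (simp add: P_def)
    then show ?thesis by auto
  qed
  moreover have "expand (P k) * mu0_series (2 * int (Suc k)) = expand (R k) * mu0_series (2 * int k)" for k
  proof -
    have "expand (P k) * X_coeff mu (2 * int (Suc k)) = expand (R k) * X_coeff mu (2 * int k)"
      using mu_coeff_rec[of "2 * int (Suc k)"]
      by (simp add: P_def R_def expand_diff expand_monom fps_of_poly_monom' nat_mult_distrib nat_add_distrib)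
    then show ?thesis
      by (simp add: mu0_series_def flip: mult.assoc)
  qed
  ultimately have step: "represents (to_fract (R k) / to_fract (P k) * r) (mu0_series (2 * int (Suc k)))"
    if "represents r (mu0_series (2 * int k))" for k r
    using that by (intro represents_step)
  have one: "represents 1 (mu0_series 0)"
    by (simp add: represents_1 mu0_series_def mu_const_unit)
  then show "moment 0 = 1" by (simp add: moment_def mu0_eqI)
  show rep: "represents (moment (int k)) (mu0_series (2 * int k))" for k
  proof (induction k)
    case 0
    show ?case using one mu0_eqI[OF one] by (simp add: moment_def)
  next
    case (Suc k)
    from step[OF this] show ?case using mu0_eqI[OF step[OF Suc]] by (simp add: moment_def)
  qed
  have "moment (int k + 1) = to_fract (R k) / to_fract (P k) * moment (int k)"
    using mu0_eqI[OF step[OF rep[of k]]] by (simp add: moment_def add.commute)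
  moreover have "to_fract (P k) \<noteq> 0" using \<open>P k \<noteq> 0\<close> by simp
  ultimately show "moment (int k + 1) * (1 - tK * qK ^ (k + 1)) = (tK - qK ^ k) * moment (int k)"
    unfolding PR[symmetric] by simp
qed

lemma moment_minus: "moment (- int k) = qK ^ k * moment (int k)"
proof -
  have "mu0_series (- (2 * int k)) = expand (monom 1 (2 * k)) * mu0_series (2 * int k)"
    using mu_coeff_neg[of "2 * int k"] by (simp add: mu0_series_def expand_monom nat_mult_distrib mult.assoc)
  then have "represents (to_fract (monom 1 (2 * k)) / to_fract 1 * moment (int k)) (mu0_series (- (2 * int k)))"
    by (intro represents_step[OF represents_moment]) simp_all
  moreover have "to_fract (monom 1 (2 * k)) = qK ^ k"
    by (simp only: to_fract_monom power_mult)
  ultimately show ?thesis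
    using mu0_eqI by (simp add: moment_def)
qed

lemma one_minus_qK_nonzero: "l \<noteq> 0 \<Longrightarrow> 1 - qK powi l \<noteq> 0"
  and one_minus_tK_qK_nonzero: "1 - tK * qK powi l \<noteq> 0"
  and one_minus_tK2_qK_nonzero: "1 - tK\<^sup>2 * qK powi l \<noteq> 0"
proof -
  have q: "qK powi l = qh powi (2 * l)" by (simp add: power_int_mult)
  show "1 - qK powi l \<noteq> 0" if "l \<noteq> 0"
    using qh_th_powi_eq_1_iff[of "2 * l" 0] that by (simp add: q)
  show "1 - tK * qK powi l \<noteq> 0"
    using qh_th_powi_eq_1_iff[of "2 * l" 2] by (simp add: q mult.commute)
  show "1 - tK\<^sup>2 * qK powi l \<noteq> 0"
    using qh_th_powi_eq_1_iff[of "2 * l" 4] by (simp add: q mult.commute)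
qed

text \<open>The reflection in \<open>moment_minus\<close> extends the recurrence to all indices: on
  the negative side it is the positive one read backwards.\<close>

lemma moment_rec: "moment l * (1 - tK * qK powi l) = (tK - qK powi (l - 1)) * moment (l - 1)"
proof (cases "l > 0")
  case True
  define k where "k = nat (l - 1)"
  then have l: "l = int (k + 1)" "l - 1 = int k" using True by simp_all
  have "qK powi l = qK ^ (k + 1)"
    by (simp only: l(1) power_int_of_nat)
  moreover have "moment l = moment (int k + 1)"
    by (simp only: l(1) of_nat_add of_nat_1)
  moreover have "qK powi (l - 1) = qK ^ k" "moment (l - 1) = moment (int k)"
    by (simp_all only: l(2) power_int_of_nat)
  ultimately show ?thesis using moment_Suc[of k] by (simp only:)
next
  case False
  define k where "k = nat (- l)"
  have l: "l = - int k" "l - 1 = - int (Suc k)" using False by (simp_all add: k_def)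
  have z: "qK ^ k * (1 - tK * inverse (qK ^ k)) = qK ^ k - tK" "(tK - inverse (qK ^ Suc k)) * qK ^ Suc k = tK * qK ^ Suc k - 1"
    by (simp_all add: field_simps)
  have "moment l * (1 - tK * qK powi l) = (qK ^ k * (1 - tK * inverse (qK ^ k))) * moment (int k)"
    unfolding l(1) moment_minus by (simp add: power_int_minus)
  also have "\<dots> = (tK * qK ^ Suc k - 1) * moment (int (Suc k))"
    unfolding z using moment_Suc[of k] by (simp add: algebra_simps)
  also have "\<dots> = (tK - inverse (qK ^ Suc k)) * qK ^ Suc k * moment (int (Suc k))"
    unfolding z ..
  also have "\<dots> = (tK - qK powi (l - 1)) * moment (l - 1)"
    unfolding l(2) moment_minus power_int_minus power_int_of_nat mult.assoc ..
  finally show ?thesis .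
qed

section \<open>Construction of the bar involution on K\<close>

definition poly_hom_eval :: "('a::comm_ring_1 \<Rightarrow> 'b::comm_ring_1) \<Rightarrow> 'b \<Rightarrow> 'a poly \<Rightarrow> 'b" where
  "poly_hom_eval h z p = poly (map_poly h p) z"

locale unital_ring_hom =
  fixes h :: "'a::comm_ring_1 \<Rightarrow> 'b::comm_ring_1"
  assumes add: "h (x + y) = h x + h y" and mult: "h (x * y) = h x * h y" and one: "h 1 = 1"
begin

lemma zero: "h 0 = 0"
  using add[of 0 0] by simp

lemma eval_pCons: "poly_hom_eval h z (pCons a p) = h a + z * poly_hom_eval h z p"
  by (simp add: poly_hom_eval_def map_poly_pCons zero)

lemma eval_0: "poly_hom_eval h z 0 = 0"
  by (simp add: poly_hom_eval_def)

lemma eval_add: "poly_hom_eval h z (p + r) = poly_hom_eval h z p + poly_hom_eval h z r"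
  by (induction p r rule: poly_induct2) (simp_all add: eval_0 eval_pCons add algebra_simps)

lemma eval_smult: "poly_hom_eval h z (smult c p) = h c * poly_hom_eval h z p"
  by (induction p) (simp_all add: eval_0 eval_pCons mult algebra_simps)

lemma eval_mult: "poly_hom_eval h z (p * r) = poly_hom_eval h z p * poly_hom_eval h z r"
  by (induction p) (simp_all add: eval_0 eval_pCons eval_add eval_smult zero algebra_simps)

lemma eval_1: "poly_hom_eval h z 1 = 1"
  by (simp add: one_pCons eval_pCons eval_0 one)

lemma eval_hom: "unital_ring_hom (poly_hom_eval h z)"
  by standard (rule eval_add eval_mult eval_1)+

lemma eval_sum: "degree p \<le> N \<Longrightarrow> poly_hom_eval h z p = (\<Sum>i\<le>N. h (coeff p i) * z ^ i)"
  unfolding poly_hom_eval_def poly_altdef coeff_map_poly[of h, OF zero, symmetric]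
  by (rule sum.mono_neutral_left) (auto simp: coeff_eq_0 intro: order.trans[OF map_poly_degree_leq])

end

definition bar_poly :: "complex poly poly \<Rightarrow> K" where
  "bar_poly = poly_hom_eval (poly_hom_eval constK (inverse th)) (inverse qh)"

lemma constK_hom: "unital_ring_hom constK"
  by standard (simp_all add: constK_def flip: one_pCons to_fract_add to_fract_mult)

lemma bar_poly_hom: "unital_ring_hom bar_poly"
  unfolding bar_poly_def by (intro unital_ring_hom.eval_hom constK_hom)

text \<open>Multiplication by q^(N/2) t^(N/2) turns the value at the inverse variables into the
  polynomial with reversed coefficients, which vanishes only if p does. This is what lets the bar
  extend to fractions.\<close>

lemma bar_poly_nonzero:
  assumes "p \<noteq> 0"
  shows "bar_poly p \<noteq> 0"
proof
  assume z: "bar_poly p = 0"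
  define N where "N = Max (insert (degree p) ((\<lambda>i. degree (coeff p i)) ` {..degree p}))"
  have d: "degree p \<le> N" by (simp add: N_def)
  have dc: "degree (coeff p i) \<le> N" for i
  proof (cases "i \<le> degree p")
    case True
    then show ?thesis unfolding N_def by (intro Max_ge) auto
  qed (simp add: coeff_eq_0)
  define S where "S = (\<Sum>i\<le>N. \<Sum>j\<le>N. monom (monom (coeff (coeff p i) j) (N - j)) (N - i))"
  have neg: "qh ^ N * inverse qh ^ i = qh ^ (N - i)" "th ^ N * inverse th ^ i = th ^ (N - i)" if "i \<le> N" for i
    using that by (simp_all add: power_diff field_simps)
  have "bar_poly p = (\<Sum>i\<le>N. (\<Sum>j\<le>N. constK (coeff (coeff p i) j) * inverse th ^ j) * inverse qh ^ i)"
    unfolding bar_poly_def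
    by (subst unital_ring_hom.eval_sum[OF unital_ring_hom.eval_hom[OF constK_hom] d])
       (simp add: unital_ring_hom.eval_sum[OF constK_hom dc])
  then have "0 = qh ^ N * th ^ N * (\<Sum>i\<le>N. (\<Sum>j\<le>N. constK (coeff (coeff p i) j) * inverse th ^ j) * inverse qh ^ i)"
    using z by simp
  also have "\<dots> = (\<Sum>i\<le>N. \<Sum>j\<le>N. constK (coeff (coeff p i) j) * ((qh ^ N * inverse qh ^ i) * (th ^ N * inverse th ^ j)))"
    unfolding sum_distrib_left sum_distrib_right
    by (intro sum.cong refl) (simp only: ac_simps)
  also have "\<dots> = (\<Sum>i\<le>N. \<Sum>j\<le>N. constK (coeff (coeff p i) j) * (qh ^ (N - i) * th ^ (N - j)))"
    using neg by (intro sum.cong refl) auto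
  also have "\<dots> = to_fract (\<Sum>i\<le>N. \<Sum>j\<le>N. monom (monom (coeff (coeff p i) j) (N - j)) (N - i))"
    by (simp add: monomial_K)
  finally have "to_fract S = 0" unfolding S_def by (rule sym)
  then have s: "S = 0" by (simp only: to_fract_eq_0_iff)
  have "coeff (coeff p i) j = 0" if "i \<le> N" "j \<le> N" for i j
  proof -
    have e: "N - k = N - i \<longleftrightarrow> k = i" "N - k = N - j \<longleftrightarrow> k = j" if "k \<le> N" for k
      using that \<open>i \<le> N\<close> \<open>j \<le> N\<close> by auto
    have "0 = coeff (coeff S (N - i)) (N - j)"
      by (simp add: s)
    also have "\<dots> = (\<Sum>k\<le>N. \<Sum>l\<le>N. if k = i then (if l = j then coeff (coeff p i) j else 0) else 0)"
      unfolding S_def coeff_sum by (intro sum.cong refl) (auto simp: e)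
    also have "\<dots> = coeff (coeff p i) j"
    proof -
      have "(\<Sum>l\<le>N. if k = i then (if l = j then coeff (coeff p i) j else 0) else 0) =
          (if k = i then coeff (coeff p i) j else 0)" for k
        using that by simp
      then show ?thesis using that by simp
    qed
    finally show ?thesis ..
  qed
  moreover obtain i where "coeff p i \<noteq> 0" using assms by (auto simp: poly_eq_iff)
  moreover from this obtain j where "coeff (coeff p i) j \<noteq> 0" by (auto simp: poly_eq_iff)
  ultimately show False using d dc by (metis coeff_eq_0 le_degree order.trans coeff_0)
qed

text \<open>Constants and the two variables generate the polynomials, and
  \<open>\<phi> 1 = 1\<close> keeps images of denominators nonzero. It serves both for the
  uniqueness of the bar and for its being an involution.\<close>

lemma K_hom_unique:
  fixes \<phi> \<psi> :: "K \<Rightarrow> K"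
  assumes \<phi>: "\<And>x y. \<phi> (x + y) = \<phi> x + \<phi> y" "\<And>x y. \<phi> (x * y) = \<phi> x * \<phi> y"
    and \<psi>: "\<And>x y. \<psi> (x + y) = \<psi> x + \<psi> y" "\<And>x y. \<psi> (x * y) = \<psi> x * \<psi> y"
    and gen: "\<And>c. \<phi> (constK c) = \<psi> (constK c)" "\<phi> qh = \<psi> qh" "\<phi> th = \<psi> th"
    and one: "\<phi> 1 = 1"
  shows "\<phi> x = \<psi> x"
proof -
  have zero: "\<phi> 0 = 0" "\<psi> 0 = 0" using \<phi>(1)[of 0 0] \<psi>(1)[of 0 0]
    by (metis add.right_neutral add_left_cancel)+
  have c: "\<phi> (to_fract [:c:]) = \<psi> (to_fract [:c:])" for c
  proof (induction c)
    case (pCons a c)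
    have "to_fract [:pCons a c:] = constK a + th * to_fract [:c:]"
      by (simp add: constK_def th_def flip: to_fract_add to_fract_mult)
    then show ?case using pCons by (simp add: \<phi> \<psi> gen)
  qed (simp add: zero)
  have p: "\<phi> (to_fract p) = \<psi> (to_fract p)" for p
  proof (induction p)
    case (pCons a p)
    have "to_fract (pCons a p) = to_fract [:a:] + qh * to_fract p"
      by (simp add: qh_def flip: to_fract_add to_fract_mult)
    then show ?case using pCons by (simp add: \<phi> \<psi> c gen)
  qed (simp add: zero)
  obtain a b where b: "b \<noteq> 0" "x = Fract a b" by (cases x) auto
  then have x: "x * to_fract b = to_fract a" by (simp add: Fract_conv_to_fract)
  have "\<phi> (to_fract b) * \<phi> (inverse (to_fract b)) = 1"
    using b one by (simp flip: \<phi>(2))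
  then have "\<phi> (to_fract b) \<noteq> 0" by auto
  moreover have "\<phi> x * \<phi> (to_fract b) = \<psi> x * \<phi> (to_fract b)"
    using x p by (metis \<phi>(2) \<psi>(2))
  ultimately show ?thesis by simp
qed

lemma ex_is_barK: "\<exists>\<phi>. is_barK \<phi>"
proof -
  interpret h: unital_ring_hom bar_poly by (rule bar_poly_hom)
  \<comment> \<open>The graph of the extension to fractions; it is single-valued by
    cross-multiplication.\<close>
  define R where "R x y \<longleftrightarrow> (\<exists>a b. b \<noteq> 0 \<and> x = Fract a b \<and> y = bar_poly a / bar_poly b)" for x y
  define \<phi> where "\<phi> x = (SOME y. R x y)" for x
  have uniq: "y = y'" if R: "R x y" "R x y'" for x y y'
  proof -
    obtain a b a' b' where ab: "b \<noteq> 0" "x = Fract a b" "y = bar_poly a / bar_poly b"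
      "b' \<noteq> 0" "x = Fract a' b'" "y' = bar_poly a' / bar_poly b'"
      using R unfolding R_def by blast
    then have "a * b' = a' * b" using eq_fract(1)[of b b' a a'] by simp
    then have "bar_poly a * bar_poly b' = bar_poly a' * bar_poly b" by (simp flip: h.mult)
    then show ?thesis using ab bar_poly_nonzero by (simp add: frac_eq_eq)
  qed
  have \<phi>: "\<phi> (Fract a b) = bar_poly a / bar_poly b" if "b \<noteq> 0" for a b
  proof -
    have R: "R (Fract a b) (bar_poly a / bar_poly b)" using that unfolding R_def by blast
    show ?thesis unfolding \<phi>_def by (rule uniq[OF someI[of "R _", OF R] R])
  qed
  have \<phi>': "\<phi> (to_fract a) = bar_poly a" for a
    using \<phi>[of 1 a] by (simp add: to_fract_def h.one)
  have "\<phi> (x + y) = \<phi> x + \<phi> y \<and> \<phi> (x * y) = \<phi> x * \<phi> y" for x y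
  proof (cases x; cases y)
    fix a b c d assume "x = Fract a b" "b \<noteq> 0" "y = Fract c d" "d \<noteq> 0"
    then show ?thesis
      using bar_poly_nonzero by (simp add: \<phi> h.add h.mult field_simps)
  qed
  moreover have "\<phi> (constK c) = constK c" "\<phi> qh = inverse qh" "\<phi> th = inverse th" for c
  proof -
    interpret c: unital_ring_hom constK by (rule constK_hom)
    interpret e: unital_ring_hom "poly_hom_eval constK (inverse th)" by (rule c.eval_hom)
    have "bar_poly [:[:c:]:] = constK c" "bar_poly [:0, 1:] = inverse qh" "bar_poly [:[:0, 1:]:] = inverse th"
      by (simp_all add: bar_poly_def e.eval_pCons e.eval_0 c.eval_pCons c.eval_0 e.zero e.one)
    then show "\<phi> (constK c) = constK c" "\<phi> qh = inverse qh" "\<phi> th = inverse th"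
      by (simp_all only: \<phi>' constK_def qh_def th_def)
  qed
  ultimately show ?thesis unfolding is_barK_def by blast
qed

lemma is_barK: "is_barK barK"
proof -
  obtain \<phi> where \<phi>: "is_barK \<phi>" using ex_is_barK ..
  have "\<psi> = \<phi>" if \<psi>: "is_barK \<psi>" for \<psi>
  proof
    fix x
    have hom: "\<chi> (x + y) = \<chi> x + \<chi> y" "\<chi> (x * y) = \<chi> x * \<chi> y" "\<chi> (constK c) = constK c"
      "\<chi> qh = inverse qh" "\<chi> th = inverse th" if "is_barK \<chi>" for \<chi> x y c
      using that unfolding is_barK_def by blast+
    have "\<psi> 1 = 1" using hom(3)[OF \<psi>, of 1] by (simp only: constK_1)
    then show "\<psi> x = \<phi> x"
      by (rule K_hom_unique[OF hom(1,2)[OF \<psi>] hom(1,2)[OF \<phi>], rotated 3])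
         (simp_all only: hom(3-5)[OF \<psi>] hom(3-5)[OF \<phi>])
  qed
  with \<phi> show ?thesis unfolding barK_def by (rule theI)
qed

lemma barK_add: "barK (x + y) = barK x + barK y"
  and barK_mult: "barK (x * y) = barK x * barK y"
  and barK_constK: "barK (constK c) = constK c"
  and barK_qh: "barK qh = inverse qh"
  and barK_th: "barK th = inverse th"
  using is_barK by (auto simp: is_barK_def)

lemma barK_1 [simp]: "barK 1 = 1"
  using barK_constK[of 1] by simp

lemma barK_0 [simp]: "barK 0 = 0"
  using barK_constK[of 0] by simp

lemma barK_diff: "barK (x - y) = barK x - barK y"
  using barK_add[of "x - y" y] by simp

lemma barK_eq_0_iff [simp]: "barK x = 0 \<longleftrightarrow> x = 0"
  using barK_mult[of x "inverse x"] by (cases "x = 0") auto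

lemma barK_inverse: "barK (inverse x) = inverse (barK x)"
  using barK_mult[of x "inverse x"] by (cases "x = 0") (auto simp: field_simps)

lemma barK_divide: "barK (x / y) = barK x / barK y"
  by (simp add: divide_inverse barK_mult barK_inverse)

lemma barK_power: "barK (x ^ n) = barK x ^ n"
  by (induction n) (simp_all add: barK_mult)

lemma barK_powi: "barK (x powi n) = barK x powi n"
  by (simp add: power_int_def barK_power barK_inverse)

lemma barK_prod: "barK (\<Prod>i\<in>A. f i) = (\<Prod>i\<in>A. barK (f i))"
  by (induction A rule: infinite_finite_induct) (simp_all add: barK_mult)

lemma barK_sum: "barK (\<Sum>i\<in>A. f i) = (\<Sum>i\<in>A. barK (f i))"
  by (induction A rule: infinite_finite_induct) (simp_all add: barK_add)

lemma barK_barK [simp]: "barK (barK x) = x"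
  using K_hom_unique[of "\<lambda>x. barK (barK x)" id x]
  by (simp add: barK_add barK_mult barK_constK barK_qh barK_th barK_inverse)

text \<open>With Q = q^k, the factor (t - Q)/(1 - tqQ) of the recurrence is multiplied by q under
  the bar. After k steps this amounts to q^k, the factor in \<open>moment_minus\<close>.\<close>

lemma barK_moment: "barK (moment l) = moment (- l)"
proof -
  have nat: "barK (moment (int k)) = moment (- int k)" for k
  proof (induction k)
    case (Suc k)
    let ?Q = "qK ^ k"
    have nz: "1 - tK * qK ^ Suc k \<noteq> 0"
      by (rule one_minus_tK_qK_nonzero[of "int (Suc k)", unfolded power_int_of_nat])
    have 1: "moment (int (Suc k)) = (tK - ?Q) * moment (int k) / (1 - tK * qK ^ Suc k)"
      using moment_Suc[of k] nz by (simp add: field_simps)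
    have 2: "barK (tK - ?Q) = (?Q - tK) / (tK * ?Q)"
      by (simp add: barK_diff barK_power barK_qh barK_th field_simps)
    have 3: "barK (1 - tK * qK ^ Suc k) = (tK * qK ^ Suc k - 1) / (tK * qK ^ Suc k)"
      by (simp add: barK_diff barK_mult barK_power barK_qh barK_th field_simps)
    have "barK (moment (int (Suc k))) = (?Q - tK) / (tK * ?Q) * (?Q * moment (int k)) * (tK * qK ^ Suc k) / (tK * qK ^ Suc k - 1)"
      unfolding 1 barK_divide barK_mult 2 Suc moment_minus using nz unfolding 3 by simp
    also have "\<dots> = qK ^ Suc k * ((tK - ?Q) * moment (int k) / (1 - tK * qK ^ Suc k))"
      using nz by (simp add: divide_simps) (simp add: algebra_simps)
    finally show ?case unfolding moment_minus 1 .
  qed (simp add: moment_0)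
  show ?thesis
  proof (cases "l \<ge> 0")
    case True then show ?thesis using nat[of "nat l"] by simp
  next
    case False
    then show ?thesis using arg_cong[OF nat[of "nat (- l)"], of barK] by simp
  qed
qed

lemma barK_mu0: "barK (mu0 n) = mu0 (- n)"
proof (cases "even n")
  case True
  then show ?thesis using barK_moment[of "n div 2"] by (simp add: moment_def)
qed (simp add: mu0_odd)

section \<open>Orthogonal polynomials\<close>

lemma const_term_superset:
  assumes "finite A" "Poly_Mapping.keys f \<subseteq> A"
  shows "const_term f g = (\<Sum>m\<in>A. Poly_Mapping.lookup f m * g (- m))"
  unfolding const_term_def using assms by (intro sum.mono_neutral_left) (auto simp: in_keys_iff)

lemma evalP_superset:
  assumes "finite A" "Poly_Mapping.keys f \<subseteq> A"
  shows "evalP f z = (\<Sum>m\<in>A. Poly_Mapping.lookup f m * z powi m)"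
  unfolding evalP_def using assms by (intro sum.mono_neutral_left) (auto simp: in_keys_iff)

lemma const_term_add: "const_term (f + f') g = const_term f g + const_term f' g"
proof -
  let ?A = "Poly_Mapping.keys f \<union> Poly_Mapping.keys f'"
  show ?thesis
    using keys_add[of f f']
    by (simp add: const_term_superset[of ?A] lookup_add algebra_simps sum.distrib)
qed

lemma evalP_add: "evalP (f + f') z = evalP f z + evalP f' z"
proof -
  let ?A = "Poly_Mapping.keys f \<union> Poly_Mapping.keys f'"
  show ?thesis
    using keys_add[of f f']
    by (simp add: evalP_superset[of ?A] lookup_add algebra_simps sum.distrib)
qed

lemma keys_single_mult_subset: "Poly_Mapping.keys (Poly_Mapping.single a c * f) \<subseteq> (+) a ` Poly_Mapping.keys f"
  for f :: "int \<Rightarrow>\<^sub>0 'a::comm_ring_1"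
  using keys_mult[of "Poly_Mapping.single a c" f] by (auto split: if_splits)

lemma const_term_single_mult: "const_term (Poly_Mapping.single a c * f) g = c * (\<Sum>m\<in>Poly_Mapping.keys f. Poly_Mapping.lookup f m * g (- a - m))"
  by (subst const_term_superset[OF _ keys_single_mult_subset])
     (simp_all add: sum.reindex lookup_single_mult sum_distrib_left mult.assoc)

lemma const_term_scale: "const_term (scale c f) g = c * const_term f g"
  unfolding const_term_single_mult by (simp add: const_term_def)

lemma evalP_single_mult:
  assumes "z \<noteq> 0"
  shows "evalP (Poly_Mapping.single a c * f) z = c * z powi a * evalP f z"
  using assms unfolding evalP_def[of f]
  by (subst evalP_superset[OF _ keys_single_mult_subset])
     (simp_all add: sum.reindex lookup_single_mult sum_distrib_left power_int_add, simp_all add: ac_simps)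

lemma const_term_0 [simp]: "const_term 0 g = 0"
  by (simp add: const_term_def)

lemma const_term_sum: "const_term (\<Sum>i\<in>A. f i) g = (\<Sum>i\<in>A. const_term (f i) g)"
  by (induction A rule: infinite_finite_induct) (simp_all add: const_term_add)

lemma const_term_Xpow: "const_term (Xpow n) g = g (- n)"
  by (simp add: const_term_def)

lemma lookup_barP: "Poly_Mapping.lookup (barP f) n = barK (Poly_Mapping.lookup f (- n))"
proof -
  have "Poly_Mapping.lookup (barP f) n = (\<Sum>m\<in>Poly_Mapping.keys f. if m = - n then barK (Poly_Mapping.lookup f m) else 0)"
    unfolding barP_def lookup_sum by (intro sum.cong) (auto simp: lookup_single when_def)
  also have "\<dots> = barK (Poly_Mapping.lookup f (- n))"
    by (simp add: in_keys_iff)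
  finally show ?thesis .
qed

lemma keys_barP: "Poly_Mapping.keys (barP f) = uminus ` Poly_Mapping.keys f"
proof (intro set_eqI iffI)
  fix x assume "x \<in> Poly_Mapping.keys (barP f)"
  then have "- x \<in> Poly_Mapping.keys f" by (simp add: in_keys_iff lookup_barP)
  then show "x \<in> uminus ` Poly_Mapping.keys f" by force
qed (auto simp: in_keys_iff lookup_barP)

lemma barP_barP [simp]: "barP (barP f) = f"
  by (rule poly_mapping_eqI) (simp add: lookup_barP)

lemma barP_add: "barP (f + g) = barP f + barP g"
  by (rule poly_mapping_eqI) (simp add: lookup_barP lookup_add barK_add)

lemma barP_0 [simp]: "barP 0 = 0"
  by (rule poly_mapping_eqI) (simp add: lookup_barP)

lemma barP_sum: "barP (\<Sum>i\<in>A. f i) = (\<Sum>i\<in>A. barP (f i))"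
  by (induction A rule: infinite_finite_induct) (simp_all add: barP_add)

lemma barP_mult: "barP (f * g) = barP f * barP g"
proof (rule poly_mapping_eqI)
  fix n
  have "Poly_Mapping.lookup (barP f * barP g) n =
    (\<Sum>k\<in>uminus ` Poly_Mapping.keys f. Poly_Mapping.lookup (barP f) k * Poly_Mapping.lookup (barP g) (n - k))"
    by (rule lookup_mult_sum) (simp_all add: keys_barP)
  also have "\<dots> = (\<Sum>k\<in>Poly_Mapping.keys f. barK (Poly_Mapping.lookup f k * Poly_Mapping.lookup g (- n - k)))"
    by (subst sum.reindex) (auto simp: lookup_barP barK_mult inj_on_def minus_diff_commute[of _ n] intro!: sum.cong)
  also have "\<dots> = Poly_Mapping.lookup (barP (f * g)) n"
    by (simp add: lookup_barP lookup_mult_sum[OF finite_keys subset_refl] barK_sum)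
  finally show "Poly_Mapping.lookup (barP (f * g)) n = Poly_Mapping.lookup (barP f * barP g) n" ..
qed

lemma barP_single: "barP (Poly_Mapping.single n c) = Poly_Mapping.single (- n) (barK c)"
  by (rule poly_mapping_eqI) (auto simp: lookup_barP lookup_single when_def)

lemma barP_scale: "barP (scale c f) = scale (barK c) (barP f)"
  by (simp add: barP_mult barP_single)

lemma const_term_barP: "const_term (barP f) mu0 = barK (const_term f mu0)"
proof -
  have "const_term (barP f) mu0 = (\<Sum>m\<in>uminus ` Poly_Mapping.keys f. Poly_Mapping.lookup (barP f) m * mu0 (- m))"
    by (simp add: const_term_def keys_barP)
  also have "\<dots> = (\<Sum>m\<in>Poly_Mapping.keys f. Poly_Mapping.lookup (barP f) (- m) * mu0 m)"
    by (subst sum.reindex) (auto simp: inj_on_def)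
  also have "\<dots> = barK (const_term f mu0)"
    by (simp add: const_term_def barK_sum barK_mult lookup_barP barK_mu0)
  finally show ?thesis .
qed

lemma const_term_mult_barP:
  "const_term (f * barP g) mu0 =
     (\<Sum>k\<in>Poly_Mapping.keys g. barK (Poly_Mapping.lookup g k) * const_term (f * Xpow (- k)) mu0)"
proof -
  have "f * Poly_Mapping.single (- k) c = scale c (f * Xpow (- k))" for k c
    by (simp add: mult.left_commute[of _ f] mult_single)
  then have "const_term (f * Poly_Mapping.single (- k) c) mu0 = c * const_term (f * Xpow (- k)) mu0" for k c
    by (metis const_term_scale)
  then show ?thesis
    unfolding barP_def sum_distrib_left const_term_sum by (intro sum.cong refl)
qed

text \<open>
  The recursion coefficients are read off the expected constant coefficients
  \<open>q\<^sup>n (1 - t) / (1 - t q\<^sup>n)\<close> of the monic polynomials; \<open>phi_star n\<close> is the reversal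
  of the conjugate of \<open>phi n\<close>.
\<close>
definition szego_gamma :: "nat \<Rightarrow> K" where
  "szego_gamma n = (1 - tK) / (1 - tK * qK ^ Suc n)"

text \<open>The bar conjugate of \<open>szego_gamma n\<close>. Writing it out lets the recursion run
  on pairs of polynomials without mentioning the bar.\<close>

definition szego_delta :: "nat \<Rightarrow> K" where
  "szego_delta n = qK ^ Suc n * szego_gamma n"

primrec szego :: "nat \<Rightarrow> laurent \<times> laurent" where
  "szego 0 = (1, 1)"
| "szego (Suc n) =
     (Xpow 2 * fst (szego n) + scale (szego_delta n) (snd (szego n)),
      snd (szego n) + scale (szego_gamma n) (Xpow 2 * fst (szego n)))"

abbreviation phi :: "nat \<Rightarrow> laurent" where "phi n \<equiv> fst (szego n)"
abbreviation phi_star :: "nat \<Rightarrow> laurent" where "phi_star n \<equiv> snd (szego n)"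

section \<open>Inner products with monomials in closed form\<close>

lemma const_term_phi_Suc:
  "const_term (phi (Suc n) * Xpow m) g =
     const_term (phi n * Xpow (m + 2)) g + szego_delta n * const_term (phi_star n * Xpow m) g"
  "const_term (phi_star (Suc n) * Xpow m) g =
     const_term (phi_star n * Xpow m) g + szego_gamma n * const_term (phi n * Xpow (m + 2)) g"
proof -
  have e: "Xpow 2 * f * Xpow m = f * Xpow (m + 2)" for f :: laurent
    by (simp add: mult.commute[of "Xpow 2" f] mult.assoc mult_single add.commute)
  show "const_term (phi (Suc n) * Xpow m) g =
     const_term (phi n * Xpow (m + 2)) g + szego_delta n * const_term (phi_star n * Xpow m) g"
   "const_term (phi_star (Suc n) * Xpow m) g =
     const_term (phi_star n * Xpow m) g + szego_gamma n * const_term (phi n * Xpow (m + 2)) g"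
    by (simp_all only: szego.simps fst_conv snd_conv distrib_right const_term_add e mult.assoc[of _ "Xpow 2 * _"]
        mult.assoc[of "Poly_Mapping.single 0 _"] const_term_scale)
qed

lemma const_term_phi_odd:
  "odd m \<Longrightarrow> const_term (phi n * Xpow m) mu0 = 0 \<and> const_term (phi_star n * Xpow m) mu0 = 0"
proof (induction n arbitrary: m)
  case 0
  then show ?case by (simp add: const_term_Xpow mu0_odd)
next
  case (Suc n)
  then show ?case unfolding const_term_phi_Suc by simp
qed

text \<open>In q-shifted factorials this is (qz; q)_n / (qtz; q)_n. At z = q^(-l) it carries the
  zeros that express orthogonality; \<open>qB\<close> does not depend on l.\<close>

definition qA :: "nat \<Rightarrow> K \<Rightarrow> K" where
  "qA n z = (\<Prod>i<n. (1 - qK ^ Suc i * z) / (1 - qK ^ Suc i * z * tK))"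

definition qB :: "nat \<Rightarrow> K" where
  "qB n = (\<Prod>i<n. (1 - qK ^ Suc i * tK\<^sup>2) / (1 - qK ^ Suc i * tK))"

lemma qA_Suc: "qA (Suc n) z = qA n z * ((1 - qK ^ Suc n * z) / (1 - qK ^ Suc n * z * tK))"
  by (simp add: qA_def)

lemma qB_Suc: "qB (Suc n) = qB n * ((1 - qK ^ Suc n * tK\<^sup>2) / (1 - qK ^ Suc n * tK))"
  by (simp add: qB_def)

lemma qA_Suc_shift: "qA (Suc n) z = (1 - qK * z) / (1 - qK * z * tK) * qA n (qK * z)"
  unfolding qA_def prod.lessThan_Suc_shift by (simp add: ac_simps)

text \<open>The numerator factors: (1 - tQ)(1 - Qzt) + (1 - t) Q (t - z) = (1 - Qz)(1 - Q t^2). With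
  Q = q^(n+1) and z = q^(-l) this is the ratio of consecutive closed forms for
  \<open>phi_star\<close>.\<close>

lemma star_step:
  fixes Q t z :: "'a::field"
  assumes "1 - t * Q \<noteq> 0" "1 - Q * z * t \<noteq> 0"
  shows "1 + (1 - t) / (1 - t * Q) * (Q * (t - z) / (1 - Q * z * t)) =
     (1 - Q * z) / (1 - Q * z * t) * ((1 - Q * t\<^sup>2) / (1 - Q * t))"
  using assms by (simp add: divide_simps mult.commute[of Q t]) (simp add: algebra_simps power2_eq_square)

lemma unstar_step:
  fixes Q t w :: "'a::field"
  assumes "1 - t * Q \<noteq> 0" "1 - Q * w * t \<noteq> 0"
  shows "Q * (t - w) / (1 - Q * w * t) + Q * ((1 - t) / (1 - t * Q)) =
     Q * ((1 - w) / (1 - Q * w * t) * ((1 - Q * t\<^sup>2) / (1 - Q * t)))"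
  using assms by (simp add: divide_simps mult.commute[of Q t]) (simp add: algebra_simps power2_eq_square)

text \<open>The classical factor 1 - |gamma|^2 by which norms change on the unit circle, with
  |gamma|^2 read as gamma times its bar.\<close>

lemma norm_step:
  fixes Q t :: "'a::field"
  assumes "1 - t * Q \<noteq> 0"
  shows "1 - (1 - t) / (1 - t * Q) * (Q * ((1 - t) / (1 - t * Q))) =
     (1 - Q * 1) / (1 - Q * 1 * t) * ((1 - Q * t\<^sup>2) / (1 - Q * t))"
  using assms by (simp add: divide_simps mult.commute[of Q t]) (simp add: algebra_simps power2_eq_square)

text \<open>One recursion step at Y = 1/t, with t standing for \<open>tK\<close>, when both
  polynomials have the same value. The right-hand sides agree, so equality of the values
  persists.\<close>

lemma eval_step:
  fixes Q t :: "'a::field"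
  assumes "1 - t * Q \<noteq> 0" "t \<noteq> 0"
  shows "inverse t + Q * ((1 - t) / (1 - t * Q)) = (1 - Q * t\<^sup>2) / (t * (1 - Q * t))"
    "1 + (1 - t) / (1 - t * Q) * inverse t = (1 - Q * t\<^sup>2) / (t * (1 - Q * t))"
  using assms
  by (simp_all add: divide_simps mult.commute[of Q t]) (simp_all add: algebra_simps power2_eq_square)

lemma qpoch_nonzero:
  "1 - tK * qK ^ n \<noteq> 0" "1 - qK ^ n * tK \<noteq> 0" "1 - qK ^ n * qK powi l * tK \<noteq> 0" "1 - qK ^ Suc n \<noteq> 0"
  "1 - qK ^ n * tK\<^sup>2 \<noteq> 0"
proof -
  show "1 - tK * qK ^ n \<noteq> 0" "1 - qK ^ n * tK \<noteq> 0"
    using one_minus_tK_qK_nonzero[of "int n"] unfolding power_int_of_nat by (simp_all only: mult.commute not_False_eq_True)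
  have "qK powi (int n + l) = qK ^ n * qK powi l"
    by (simp add: power_int_add)
  then show "1 - qK ^ n * qK powi l * tK \<noteq> 0"
    using one_minus_tK_qK_nonzero[of "int n + l"] by (simp only: mult.commute not_False_eq_True)
  show "1 - qK ^ Suc n \<noteq> 0"
    by (rule one_minus_qK_nonzero[of "int (Suc n)", unfolded power_int_of_nat]) simp
  show "1 - qK ^ n * tK\<^sup>2 \<noteq> 0"
    using one_minus_tK2_qK_nonzero[of "int n"] unfolding power_int_of_nat by (simp only: mult.commute not_False_eq_True)
qed

text \<open>\<open>moment_rec\<close> read downwards in the variable z = q^(-l) of
  \<open>qA\<close>; its denominator 1 - qzt is then the first denominator of
  \<open>qA\<close>.\<close>

lemma moment_prev: "moment (l - 1) = qK * (tK - qK powi (- l)) / (1 - qK * qK powi (- l) * tK) * moment l"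
proof -
  have nz: "1 - qK * qK powi (- l) * tK \<noteq> 0" using qpoch_nonzero(3)[of 1 "- l"] by simp
  have 1: "qK powi l * qK powi (- l) = 1" "qK powi (l - 1) * qK = qK powi l"
    by (simp_all add: power_int_minus power_int_diff)
  have "qK * (qK powi (- l) * (moment l * (1 - tK * qK powi l))) = qK * (qK powi (- l) * ((tK - qK powi (l - 1)) * moment (l - 1)))"
    by (simp only: moment_rec)
  moreover have "qK * (qK powi (- l) * (moment l * (1 - tK * qK powi l))) = qK * (qK powi (- l) - tK * (qK powi l * qK powi (- l))) * moment l"
    by (simp only: algebra_simps mult_1)
  moreover have "qK * (qK powi (- l) * ((tK - qK powi (l - 1)) * moment (l - 1))) =
      (qK * qK powi (- l) * tK - (qK powi (l - 1) * qK) * qK powi (- l)) * moment (l - 1)"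
    by (simp only: algebra_simps)
  ultimately have "qK * (qK powi (- l) - tK) * moment l = (qK * qK powi (- l) * tK - 1) * moment (l - 1)"
    by (simp only: 1 mult_1_right)
  then have "(1 - qK * qK powi (- l) * tK) * moment (l - 1) = qK * (tK - qK powi (- l)) * moment l"
    by (simp only: left_diff_distrib right_diff_distrib mult_1) (simp add: algebra_simps)
  then show ?thesis using nz by (simp add: field_simps)
qed

text \<open>
  With the parameters \<open>l\<close> shifted by one, the two families of inner products have a rational ratio;
  this makes the simultaneous induction close.
\<close>
lemma const_term_phi_star:
  "const_term (phi_star n * Xpow (- 2 * l)) mu0 = moment l * qA n (qK powi (- l)) * qB n"
  and const_term_phi:
  "const_term (phi n * Xpow (- 2 * l + 2)) mu0 =
     qK ^ Suc n * (tK - qK powi (- l)) / (1 - qK ^ Suc n * qK powi (- l) * tK) * (moment l * qA n (qK powi (- l)) * qB n)"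
proof (induction n arbitrary: l)
  case 0
  {
    case 1
    show ?case by (simp add: const_term_Xpow qA_def qB_def moment_def)
  next
    case 2
    have "const_term (phi 0 * Xpow (- 2 * l + 2)) mu0 = moment (l - 1)"
      by (simp add: const_term_Xpow moment_def algebra_simps)
    then show ?case unfolding moment_prev by (simp add: qA_def qB_def)
  }
next
  case (Suc n)
  let ?Q = "qK ^ Suc n"
  {
    case (1 l)
    let ?z = "qK powi (- l)"
    have "const_term (phi_star (Suc n) * Xpow (- 2 * l)) mu0 =
       (1 + szego_gamma n * (?Q * (tK - ?z) / (1 - ?Q * ?z * tK))) * (moment l * qA n ?z * qB n)"
    proof -
      have "M + c * (d * M) = (1 + c * d) * M" for M c d :: K
        by (simp add: algebra_simps)
      then show ?thesis unfolding const_term_phi_Suc Suc .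
    qed
    also have "\<dots> = moment l * qA (Suc n) ?z * qB (Suc n)"
      unfolding szego_gamma_def star_step[OF qpoch_nonzero(1,3)] qA_Suc qB_Suc by (simp only: ac_simps)
    finally show ?case .
  next
    case (2 l)
    let ?z = "qK powi (- l)"
    \<comment> \<open>Both induction hypotheses are used at l - 1, where q^(-l) is replaced by q
      q^(-l); \<open>moment_prev\<close> and \<open>qA_Suc_shift\<close> lead back to l.\<close>
    let ?w = "qK * ?z"
    have w: "qK powi (- (l - 1)) = ?w" by (simp add: power_int_diff power_int_minus field_simps)
    have nz: "1 - ?Q * ?w * tK \<noteq> 0"
      using qpoch_nonzero(3)[of "Suc (Suc n)" "- l"] by (simp only: power_Suc mult.assoc mult.left_commute not_False_eq_True)
    have i: "- 2 * l + 2 + 2 = - 2 * (l - 1) + 2" "- 2 * l + 2 = - 2 * (l - 1)" by simp_all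
    have "const_term (phi (Suc n) * Xpow (- 2 * l + 2)) mu0 =
       const_term (phi n * Xpow (- 2 * (l - 1) + 2)) mu0 + szego_delta n * const_term (phi_star n * Xpow (- 2 * (l - 1))) mu0"
      unfolding const_term_phi_Suc i ..
    also have "\<dots> = (?Q * (tK - ?w) / (1 - ?Q * ?w * tK) + ?Q * ((1 - tK) / (1 - tK * ?Q))) * (moment (l - 1) * qA n ?w * qB n)"
      unfolding Suc w szego_delta_def szego_gamma_def by (simp only: distrib_right)
    also have "\<dots> = ?Q * ((1 - ?w) / (1 - ?Q * ?w * tK) * ((1 - ?Q * tK\<^sup>2) / (1 - ?Q * tK))) *
       (qK * (tK - ?z) / (1 - qK * ?z * tK) * moment l * qA n ?w * qB n)"
      unfolding unstar_step[OF qpoch_nonzero(1) nz] moment_prev ..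
    also have "\<dots> = qK ^ Suc (Suc n) * (tK - ?z) / (1 - qK ^ Suc (Suc n) * ?z * tK) * (moment l * qA (Suc n) ?z * qB (Suc n))"
    proof -
      have e: "1 - qK ^ Suc (Suc n) * ?z * tK = 1 - ?Q * ?w * tK" by (simp only: power_Suc ac_simps)
      show ?thesis
        unfolding qA_Suc_shift qB_Suc e
        by (simp only: power_Suc times_divide_eq_left times_divide_eq_right divide_divide_eq_left) (simp only: ac_simps)
    qed
    finally show ?case .
  }
qed

text \<open>The factor with index l - 1 is 1 - q^l q^(-l) = 0.\<close>

lemma qA_eq_0:
  assumes "1 \<le> l" "l \<le> int n"
  shows "qA n (qK powi (- l)) = 0"
proof -
  have "nat (l - 1) < n" using assms by auto
  moreover have "qK ^ Suc (nat (l - 1)) * qK powi (- l) = qK powi (int (Suc (nat (l - 1))) + (- l))"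
    by (simp only: power_int_add power_int_of_nat qh_nonzero power_not_zero simp_thms)
  then have "qK ^ Suc (nat (l - 1)) * qK powi (- l) = 1" using assms by simp
  ultimately show ?thesis
    unfolding qA_def by (intro prod_zero bexI[of _ "nat (l - 1)"]) simp_all
qed

lemma phi_star_orthogonal:
  "1 \<le> l \<Longrightarrow> l \<le> int n \<Longrightarrow> const_term (phi_star n * Xpow (- 2 * l)) mu0 = 0"
  by (simp only: const_term_phi_star qA_eq_0 mult_zero_left mult_zero_right)

lemma phi_orthogonal:
  assumes "0 \<le> l" "l < int n"
  shows "const_term (phi n * Xpow (- 2 * l)) mu0 = 0"
proof -
  have "- 2 * l = - 2 * (l + 1) + 2" by simp
  then show ?thesis using assms
    by (simp only: const_term_phi qA_eq_0[of "l + 1"] mult_zero_left mult_zero_right)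
qed

lemma phi_star_norm: "const_term (phi_star n) mu0 = qA n 1 * qB n"
  using const_term_phi_star[of n 0] by (simp add: moment_0)

text \<open>Orthogonality of the next \<open>phi_star\<close> to Y^(n+1) determines the one unknown
  inner product \<open>?v\<close>; the norm is then multiplied by 1 - gamma delta.\<close>

lemma phi_norm: "const_term (phi n * Xpow (- 2 * int n)) mu0 = qA n 1 * qB n"
proof (induction n)
  case 0
  show ?case by (simp add: qA_def qB_def const_term_Xpow[of 0, simplified] moment_0[unfolded moment_def, simplified])
next
  case (Suc n)
  let ?u = "const_term (phi n * Xpow (- 2 * int n)) mu0"
  let ?v = "const_term (phi_star n * Xpow (- 2 * int (Suc n))) mu0"
  have i: "- 2 * int (Suc n) + 2 = - 2 * int n" by simp
  have "0 = ?v + szego_gamma n * ?u"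
    using phi_star_orthogonal[of "int (Suc n)" "Suc n"] unfolding const_term_phi_Suc i by simp
  then have v: "?v = - (szego_gamma n * ?u)" by (metis add_eq_0_iff2)
  have "const_term (phi (Suc n) * Xpow (- 2 * int (Suc n))) mu0 = ?u + szego_delta n * ?v"
    unfolding const_term_phi_Suc i ..
  also have "\<dots> = (1 - szego_gamma n * szego_delta n) * ?u"
  proof -
    have "u + d * - (c * u) = (1 - c * d) * u" for u c d :: K
      by (simp add: algebra_simps)
    then show ?thesis unfolding v .
  qed
  also have "\<dots> = qA (Suc n) 1 * qB (Suc n)"
    unfolding szego_delta_def szego_gamma_def norm_step[OF qpoch_nonzero(1)] Suc qA_Suc qB_Suc by (simp only: ac_simps)
  finally show ?case .
qed

section \<open>Values at -k/2 and supports\<close>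

definition phi_at_sharp0 :: "nat \<Rightarrow> K" where
  "phi_at_sharp0 n = (\<Prod>i<n. (1 - qK ^ Suc i * tK\<^sup>2) / (tK * (1 - qK ^ Suc i * tK)))"

lemma evalP_phi:
  "evalP (phi n) (inverse th) = phi_at_sharp0 n \<and> evalP (phi_star n) (inverse th) = phi_at_sharp0 n"
proof (induction n)
  case 0
  have "evalP 1 z = 1" for z by (simp add: evalP_def)
  then show ?case by (simp add: phi_at_sharp0_def)
next
  case (Suc n)
  let ?E = "phi_at_sharp0 n" and ?Q = "qK ^ Suc n"
  have X: "evalP (Xpow 2 * f) (inverse th) = inverse tK * evalP f (inverse th)" for f
    by (simp add: evalP_single_mult power_int_numeral power_inverse)
  have S: "evalP (scale c f) (inverse th) = c * evalP f (inverse th)" for c f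
    by (simp add: evalP_single_mult)
  have E: "phi_at_sharp0 (Suc n) = (1 - ?Q * tK\<^sup>2) / (tK * (1 - ?Q * tK)) * ?E"
    by (simp add: phi_at_sharp0_def mult.commute)
  have tK0: "tK \<noteq> 0" by simp
  have "evalP (phi (Suc n)) (inverse th) = (inverse tK + ?Q * ((1 - tK) / (1 - tK * ?Q))) * ?E"
    by (simp only: szego.simps fst_conv evalP_add X S Suc distrib_right szego_delta_def szego_gamma_def)
  moreover have "evalP (phi_star (Suc n)) (inverse th) = (1 + (1 - tK) / (1 - tK * ?Q) * inverse tK) * ?E"
    by (simp only: szego.simps snd_conv evalP_add X S Suc distrib_right szego_gamma_def mult_1 mult.assoc)
  ultimately show ?case
    unfolding eval_step[OF qpoch_nonzero(1) tK0] E by simp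
qed

text \<open>The gap of 2 next to the top term of \<open>phi\<close> and next to the constant term of
  \<open>phi_star\<close> is what makes X^n, after a shift, the only monomial that is not
  lower.\<close>

lemma phi_support:
  "(\<forall>m. Poly_Mapping.lookup (phi n - Xpow (2 * int n)) m \<noteq> 0 \<longrightarrow> 0 \<le> m \<and> m \<le> 2 * int n - 2) \<and>
   (\<forall>m. Poly_Mapping.lookup (phi_star n - 1) m \<noteq> 0 \<longrightarrow> 2 \<le> m \<and> m \<le> 2 * int n)"
proof (induction n)
  case (Suc n)
  have p: "Poly_Mapping.lookup (phi n) m \<noteq> 0 \<Longrightarrow> 0 \<le> m \<and> m \<le> 2 * int n" for m
    using conjunct1[OF Suc, rule_format, of m] by (fastforce simp: lookup_minus lookup_single when_def split: if_splits)
  have r: "Poly_Mapping.lookup (phi_star n) m \<noteq> 0 \<Longrightarrow> 0 \<le> m \<and> m \<le> 2 * int n" for m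
    using conjunct2[OF Suc, rule_format, of m] by (fastforce simp: lookup_minus lookup_one when_def split: if_splits)
  have 1: "Poly_Mapping.lookup (phi (Suc n) - Xpow (2 * int (Suc n))) m =
     Poly_Mapping.lookup (phi n - Xpow (2 * int n)) (m - 2) + szego_delta n * Poly_Mapping.lookup (phi_star n) m" for m
    by (simp add: lookup_minus lookup_add lookup_single_mult lookup_single when_def)
  have 2: "Poly_Mapping.lookup (phi_star (Suc n) - 1) m =
     Poly_Mapping.lookup (phi_star n - 1) m + szego_gamma n * Poly_Mapping.lookup (phi n) (m - 2)" for m
    by (simp add: lookup_minus lookup_add lookup_single_mult)
  show ?case
  proof (intro conjI allI impI)
    fix m assume "Poly_Mapping.lookup (phi (Suc n) - Xpow (2 * int (Suc n))) m \<noteq> 0"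
    then have "Poly_Mapping.lookup (phi n - Xpow (2 * int n)) (m - 2) \<noteq> 0 \<or> Poly_Mapping.lookup (phi_star n) m \<noteq> 0"
      unfolding 1 by auto
    then show "0 \<le> m" "m \<le> 2 * int (Suc n) - 2"
      using conjunct1[OF Suc, rule_format, of "m - 2"] r[of m] by auto
  next
    fix m assume "Poly_Mapping.lookup (phi_star (Suc n) - 1) m \<noteq> 0"
    then have "Poly_Mapping.lookup (phi_star n - 1) m \<noteq> 0 \<or> Poly_Mapping.lookup (phi n) (m - 2) \<noteq> 0"
      unfolding 2 by auto
    then show "2 \<le> m" "m \<le> 2 * int (Suc n)"
      using conjunct2[OF Suc, rule_format, of m] p[of "m - 2"] by auto
  qed
qed simp

text \<open>
  The position in the order \<open>0, 1, -1, 2, -2, \<dots>\<close> of the exponents.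
\<close>
definition rank :: "int \<Rightarrow> nat" where
  "rank n = (if n > 0 then 2 * nat n - 1 else 2 * nat (- n))"

lemma lower_iff_rank: "lower m n \<longleftrightarrow> rank m < rank n"
  by (auto simp: lower_def rank_def)

lemma inj_rank: "inj rank"
proof (rule injI)
  fix m n assume "rank m = rank n"
  then have "\<not> lower m n" "\<not> lower n m" by (simp_all add: lower_iff_rank)
  then show "m = n" by (auto simp: lower_def)
qed

lemma ex_rank: "\<exists>n. rank n = r"
proof (cases "even r")
  case True
  then show ?thesis by (intro exI[of _ "- int (r div 2)"]) (auto simp: rank_def)
next
  case False
  then show ?thesis by (intro exI[of _ "int (Suc r div 2)"]) (auto simp: rank_def elim!: oddE)
qed

lemma finite_rank: "finite {m. rank m < r}"
  using finite_vimageI[OF finite_lessThan[of r] inj_rank] by (simp add: vimage_def)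

section \<open>The nonsymmetric polynomials in explicit form\<close>

definition szego_index :: "int \<Rightarrow> nat" where
  "szego_index n = (if n > 0 then nat n - 1 else nat (- n))"

text \<open>The shifted exponents lie between 2 - n and n for positive n, with X^n on top, and
  between n and -n otherwise, with X^n at the bottom. The indices n and 1 - n share a Szego index,
  which matches the symmetry of \<open>mu1\<close>.\<close>

definition e_explicit :: "int \<Rightarrow> laurent" where
  "e_explicit n = (if n > 0 then Xpow (2 - n) * phi (szego_index n) else Xpow n * phi_star (szego_index n))"

lemma e_explicit_support:
  assumes "Poly_Mapping.lookup (e_explicit n - Xpow n) m \<noteq> 0"
  shows "lower m n"
proof (cases "n > 0")
  case True
  have "Poly_Mapping.lookup (e_explicit n - Xpow n) m =
     Poly_Mapping.lookup (phi (szego_index n) - Xpow (2 * int (szego_index n))) (m + n - 2)"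
    using True by (auto simp: e_explicit_def szego_index_def lookup_minus lookup_single_mult lookup_single when_def algebra_simps)
  then show ?thesis
    using assms phi_support[of "szego_index n", THEN conjunct1, rule_format, of "m + n - 2"] True
    by (auto simp: lower_def szego_index_def)
next
  case False
  have "Poly_Mapping.lookup (e_explicit n - Xpow n) m =
     Poly_Mapping.lookup (phi_star (szego_index n) - 1) (m - n)"
    using False by (auto simp: e_explicit_def lookup_minus lookup_single_mult lookup_single lookup_one when_def)
  then show ?thesis
    using assms phi_support[of "szego_index n", THEN conjunct2, rule_format, of "m - n"] False
    by (auto simp: lower_def szego_index_def)
qed

lemma not_lower_refl: "\<not> lower n n"
  by (auto simp: lower_def)

lemma e_explicit_lookup:
  "Poly_Mapping.lookup (e_explicit n) n = 1"
  "Poly_Mapping.lookup (e_explicit n) m \<noteq> 0 \<Longrightarrow> m \<noteq> n \<Longrightarrow> lower m n"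
  using e_explicit_support[of n n] e_explicit_support[of n m] not_lower_refl[of n]
  by (auto simp: lookup_minus lookup_single_not_eq)

lemma e_explicit_mult_Xpow:
  "e_explicit n * Xpow m =
     (if n > 0 then phi (szego_index n) * Xpow (m + 2 - n) else phi_star (szego_index n) * Xpow (m + n))"
proof -
  have "Xpow a * f * Xpow m = f * Xpow (m + a)" for a and f :: laurent
    by (simp add: mult.commute[of "Xpow a" f] mult.assoc mult_single add.commute)
  then show ?thesis
    by (cases "n > 0") (simp_all only: e_explicit_def if_True if_False add_diff_eq)
qed

text \<open>Exponents of the wrong parity give odd moments, which vanish. The lower exponents of the
  right parity are exactly those covered by \<open>phi_orthogonal\<close> and
  \<open>phi_star_orthogonal\<close>.\<close>

lemma e_explicit_orthogonal:
  assumes "lower m n"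
  shows "const_term (e_explicit n * Xpow (- m)) mu0 = 0"
proof (cases "even (m + n)")
  case False
  then show ?thesis by (simp add: e_explicit_mult_Xpow const_term_phi_odd)
next
  case True
  then obtain k where k: "m + n = 2 * k" ..
  show ?thesis
  proof (cases "n > 0")
    case n: True
    have "0 \<le> k - 1" "k - 1 < int (szego_index n)"
      using assms k n by (auto simp: lower_def szego_index_def)
    then have "const_term (phi (szego_index n) * Xpow (- 2 * (k - 1))) mu0 = 0"
      by (rule phi_orthogonal)
    moreover have "- 2 * (k - 1) = - m + 2 - n" using k by simp
    ultimately show ?thesis using n by (simp only: e_explicit_mult_Xpow if_True)
  next
    case n: False
    have "1 \<le> k - n" "k - n \<le> int (szego_index n)"
      using assms k n by (auto simp: lower_def szego_index_def)
    then have "const_term (phi_star (szego_index n) * Xpow (- 2 * (k - n))) mu0 = 0"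
      by (rule phi_star_orthogonal)
    moreover have "- 2 * (k - n) = - m + n" using k by simp
    ultimately show ?thesis using n by (simp only: e_explicit_mult_Xpow if_False)
  qed
qed

lemma e_explicit_norm:
  "const_term (e_explicit n * Xpow (- n)) mu0 = qA (szego_index n) 1 * qB (szego_index n)"
proof (cases "n > 0")
  case True
  then have "- n + 2 - n = - 2 * int (szego_index n)" by (simp add: szego_index_def)
  then show ?thesis using True phi_norm by (simp only: e_explicit_mult_Xpow if_True)
next
  case False
  then show ?thesis using phi_star_norm by (simp add: e_explicit_mult_Xpow)
qed

lemma e_explicit_norm_nonzero: "qA n 1 * qB n \<noteq> 0"
  using qpoch_nonzero(3)[of _ 0] qpoch_nonzero(2,4,5) by (simp add: qA_def qB_def del: power_Suc)

text \<open>If the barred polynomial has smaller rank, all its monomials are lower and the pairing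
  vanishes; the opposite case follows by Hermitian symmetry. On the diagonal only the leading
  monomial contributes.\<close>

lemma e_explicit_gram:
  "const_term (e_explicit n * barP (e_explicit m)) mu0 =
     (if n = m then qA (szego_index n) 1 * qB (szego_index n) else 0)"
proof -
  have vanish: "const_term (e_explicit n * barP g) mu0 = 0"
    if "\<And>k. k \<in> Poly_Mapping.keys g \<Longrightarrow> lower k n" for n g
    unfolding const_term_mult_barP using that e_explicit_orthogonal by (intro sum.neutral) simp
  have less: "const_term (e_explicit n * barP (e_explicit m)) mu0 = 0" if "rank m < rank n" for n m
  proof (rule vanish)
    fix k assume "k \<in> Poly_Mapping.keys (e_explicit m)"
    then have "k = m \<or> lower k m" using e_explicit_lookup(2)[of m k] by (auto simp: in_keys_iff)
    then show "lower k n" using that by (auto simp: lower_iff_rank)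
  qed
  consider "n = m" | "rank m < rank n" | "rank n < rank m"
    using injD[OF inj_rank, of n m] by linarith
  then show ?thesis
  proof cases
    case 1
    have "const_term (e_explicit n * barP (e_explicit n - Xpow n)) mu0 = 0"
      by (rule vanish) (auto simp: in_keys_iff intro: e_explicit_support)
    moreover have "e_explicit n * barP (e_explicit n) = e_explicit n * barP (e_explicit n - Xpow n) + e_explicit n * Xpow (- n)"
      by (simp add: barP_single flip: distrib_left barP_add) (simp add: barP_single[of n 1, simplified, symmetric] flip: barP_add)
    ultimately show ?thesis using 1 e_explicit_norm by (simp add: const_term_add)
  next
    case 2
    then show ?thesis using less by auto
  next
    case 3
    have "e_explicit n * barP (e_explicit m) = barP (e_explicit m * barP (e_explicit n))"
      by (simp add: barP_mult mult.commute)
    then have "const_term (e_explicit n * barP (e_explicit m)) mu0 = barK (const_term (e_explicit m * barP (e_explicit n)) mu0)"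
      by (simp only: const_term_barP)
    then show ?thesis using less[OF 3] 3 by auto
  qed
qed

lemma e_explicit_span:
  assumes "\<And>m. m \<in> Poly_Mapping.keys f \<Longrightarrow> rank m < r"
  shows "\<exists>c. f = (\<Sum>m | rank m < r. scale (c m) (e_explicit m))"
  using assms
proof (induction r arbitrary: f)
  case 0
  then have "Poly_Mapping.keys f = {}" by blast
  then show ?case by simp
next
  case (Suc r)
  obtain n where n: "rank n = r" using ex_rank by blast
  let ?a = "Poly_Mapping.lookup f n"
  let ?g = "f - scale ?a (e_explicit n)"
  have "rank m < r" if "m \<in> Poly_Mapping.keys ?g" for m
  proof -
    have g: "Poly_Mapping.lookup ?g m = Poly_Mapping.lookup f m - ?a * Poly_Mapping.lookup (e_explicit n) m"
      by (simp add: lookup_minus lookup_single_mult)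
    have "m \<noteq> n" using that g e_explicit_lookup(1) by (auto simp: in_keys_iff)
    moreover have "Poly_Mapping.lookup f m \<noteq> 0 \<or> Poly_Mapping.lookup (e_explicit n) m \<noteq> 0"
      using that g by (auto simp: in_keys_iff)
    ultimately show ?thesis
      using Suc.prems[of m] e_explicit_lookup(2)[of n m] n inj_eq[OF inj_rank, of m n]
      by (auto simp: in_keys_iff lower_iff_rank less_Suc_eq)
  qed
  from Suc.IH[OF this] obtain c where c: "?g = (\<Sum>m | rank m < r. scale (c m) (e_explicit m))" by blast
  have set: "{m. rank m < Suc r} = insert n {m. rank m < r}" "n \<notin> {m. rank m < r}"
    unfolding n[symmetric] less_Suc_eq inj_eq[OF inj_rank] by auto
  have "(\<Sum>m | rank m < r. scale ((c(n := ?a)) m) (e_explicit m)) = ?g"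
    unfolding c using set(2) by (intro sum.cong) auto
  then have "f = (\<Sum>m | rank m < Suc r. scale ((c(n := ?a)) m) (e_explicit m))"
    unfolding set(1) sum.insert[OF finite_rank set(2)] by (simp only: fun_upd_same) simp
  then show ?case by blast
qed

text \<open>Two solutions differ by a combination of polynomials of smaller rank that is orthogonal
  to all of them; the norms are nonzero, so it vanishes.\<close>

lemma e_poly_eq: "e_poly n = e_explicit n"
  unfolding e_poly_def
proof (rule the_equality)
  show "is_e n (e_explicit n)"
    using e_explicit_support e_explicit_orthogonal by (auto simp: is_e_def in_keys_iff)
  fix e assume e: "is_e n e"
  let ?d = "e - e_explicit n"
  have keys: "lower m n" if "m \<in> Poly_Mapping.keys ?d" for m
  proof (rule ccontr)
    assume "\<not> lower m n"
    then have "Poly_Mapping.lookup (e - Xpow n) m = 0" "Poly_Mapping.lookup (e_explicit n - Xpow n) m = 0"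
      using e e_explicit_support by (auto simp: is_e_def in_keys_iff)
    then show False using that by (simp add: in_keys_iff lookup_minus)
  qed
  have "const_term (?d * Xpow (- m)) mu0 = 0" if "lower m n" for m
  proof -
    have "e * Xpow (- m) = ?d * Xpow (- m) + e_explicit n * Xpow (- m)"
      by (simp flip: distrib_right)
    then have "const_term (e * Xpow (- m)) mu0 = const_term (?d * Xpow (- m)) mu0 + const_term (e_explicit n * Xpow (- m)) mu0"
      by (simp only: const_term_add)
    then show ?thesis using e e_explicit_orthogonal[OF that] that by (simp add: is_e_def)
  qed
  note d = this
  have orth: "const_term (?d * barP (e_explicit m)) mu0 = 0" if "rank m < rank n" for m
    unfolding const_term_mult_barP
  proof (intro sum.neutral ballI)
    fix k assume "k \<in> Poly_Mapping.keys (e_explicit m)"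
    then have "k = m \<or> lower k m" using e_explicit_lookup(2)[of m k] by (auto simp: in_keys_iff)
    then have "lower k n" using that by (auto simp: lower_iff_rank)
    then show "barK (Poly_Mapping.lookup (e_explicit m) k) * const_term (?d * Xpow (- k)) mu0 = 0"
      by (simp only: d mult_zero_right)
  qed
  obtain c where c: "?d = (\<Sum>m | rank m < rank n. scale (c m) (e_explicit m))"
    using e_explicit_span[of ?d "rank n"] keys by (auto simp: lower_iff_rank)
  have "c k = 0" if "rank k < rank n" for k
  proof -
    have "0 = (\<Sum>m | rank m < rank n. const_term (scale (c m) (e_explicit m * barP (e_explicit k))) mu0)"
      using orth[OF that] unfolding c sum_distrib_right const_term_sum by (simp add: mult.assoc)
    also have "\<dots> = (\<Sum>m | rank m < rank n. if m = k then c k * (qA (szego_index k) 1 * qB (szego_index k)) else 0)"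
      by (intro sum.cong refl) (simp add: const_term_scale e_explicit_gram)
    also have "\<dots> = c k * (qA (szego_index k) 1 * qB (szego_index k))"
      using that finite_rank by simp
    finally show ?thesis using e_explicit_norm_nonzero by simp
  qed
  then have "?d = 0" unfolding c by (intro sum.neutral) simp
  then show "e = e_explicit n" by simp
qed

section \<open>Normalisation and the discrete weight\<close>

lemma sharp_0: "sharp 0 = inverse th"
  by (simp add: sharp_def sgn_sharp_def power_int_minus)

lemma evalP_e_poly:
  "evalP (e_poly n) (sharp 0) = inverse th powi (if n > 0 then 2 - n else n) * phi_at_sharp0 (szego_index n)"
  using evalP_phi by (simp add: e_poly_eq e_explicit_def sharp_0 evalP_single_mult)

lemma phi_at_sharp0_nonzero: "phi_at_sharp0 n \<noteq> 0"
  using qpoch_nonzero(2,5) by (simp add: phi_at_sharp0_def del: power_Suc)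

lemma barK_phi_at_sharp0:
  "barK (phi_at_sharp0 n) = (\<Prod>i<n. (1 - qK ^ Suc i * tK\<^sup>2) / (1 - qK ^ Suc i * tK))"
proof -
  have "barK ((1 - Q * tK\<^sup>2) / (tK * (1 - Q * tK))) = (1 - Q * tK\<^sup>2) / (1 - Q * tK)"
    if Q: "Q = qK ^ Suc i" for i Q
  proof -
    have nz: "Q \<noteq> 0" "tK \<noteq> 0" by (simp_all add: Q)
    have b: "barK Q = inverse Q" "barK tK = inverse tK"
      by (simp_all add: Q barK_mult barK_power barK_qh barK_th field_simps)
    have id: "(1 - inverse Q * (inverse t)\<^sup>2) / (inverse t * (1 - inverse Q * inverse t)) = (1 - Q * t\<^sup>2) / (1 - Q * t)"
      if "Q \<noteq> 0" "t \<noteq> 0" "1 - Q * t \<noteq> 0" for Q t :: K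
    proof -
      have 1: "1 - inverse Q * (inverse t)\<^sup>2 = (Q * t\<^sup>2 - 1) / (Q * t\<^sup>2)"
        "inverse t * (1 - inverse Q * inverse t) = (Q * t - 1) / (Q * t\<^sup>2)"
        using that by (simp_all add: field_simps power2_eq_square)
      show ?thesis unfolding 1 using that by (simp add: divide_simps) (simp add: algebra_simps)
    qed
    show ?thesis
      unfolding barK_divide barK_mult barK_diff barK_1 barK_power[of tK 2] b
      using nz qpoch_nonzero(2)[of "Suc i", folded Q] by (rule id)
  qed
  then show ?thesis by (simp add: phi_at_sharp0_def barK_prod del: power_Suc)
qed

lemma inj_sharp: "inj sharp"
proof (rule injI)
  fix m n assume "sharp m = sharp n"
  then have "qh powi m * th powi sgn_sharp m * (qh powi (- n) * th powi (- sgn_sharp n)) = 1"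
    by (simp add: sharp_def power_int_minus field_simps)
  then have "qh powi (m + - n) * th powi (sgn_sharp m + - sgn_sharp n) = 1"
    by (simp add: power_int_add ac_simps del: add_uminus_conv_diff)
  then have "m + - n = 0" by (simp only: qh_th_powi_eq_1_iff)
  then show "m = n" by simp
qed

lemma on_Zsharp_sharp [simp]: "on_Zsharp g (sharp n) = g n"
  by (simp add: on_Zsharp_def Zsharp_def inv_f_f[OF inj_sharp])

text \<open>The power of t in \<open>mu1_pos\<close> is distributed over the factors, which makes
  every single factor bar-invariant.\<close>

definition mu1_weight :: "int \<Rightarrow> K" where
  "mu1_weight n = (\<Prod>i<szego_index n. (1 - qK ^ Suc i * tK\<^sup>2) / (tK * (1 - qK ^ Suc i)))"

lemma mu1_sharp: "mu1 (sharp n) = mu1_weight n"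
proof -
  have p: "(\<Prod>j\<in>{1..int k}. f j) = (\<Prod>i<k. f (int (Suc i)))" for f :: "int \<Rightarrow> K" and k
  proof (induction k)
    case (Suc k)
    have "{1..int (Suc k)} = insert (int (Suc k)) {1..int k}" by auto
    then show ?case using Suc by (simp add: mult.commute)
  qed simp
  have t: "tK powi (- int k) * (\<Prod>i<k. a i) = (\<Prod>i<k. a i / tK)" for a :: "nat \<Rightarrow> K" and k
  proof -
    have "inverse tK ^ k * (\<Prod>i<k. a i) = (\<Prod>i<k. a i / tK)"
      by (induction k) (simp_all add: field_simps)
    then show ?thesis by (simp only: power_int_minus power_int_of_nat power_inverse)
  qed
  have "mu1 (sharp n) = mu1_pos (if n > 0 then n else 1 - n)"
    by (simp add: mu1_def)
  also have "\<dots> = mu1_pos (int (szego_index n) + 1)"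
    by (rule arg_cong[of _ _ mu1_pos]) (auto simp: szego_index_def)
  also have "\<dots> = (\<Prod>i<szego_index n. (1 - tK\<^sup>2 * qK ^ Suc i) / (1 - qK ^ Suc i) / tK)"
    unfolding mu1_pos_def add_diff_cancel_right' p t power_int_of_nat ..
  also have "\<dots> = mu1_weight n"
    unfolding mu1_weight_def by (intro prod.cong refl) (simp only: divide_divide_eq_left mult.commute)
  finally show ?thesis .
qed

lemma mu1_weight_nonzero: "mu1_weight n \<noteq> 0"
  using qpoch_nonzero(4,5) by (simp add: mu1_weight_def del: power_Suc)

text \<open>In \<open>E1\<close> and \<open>E1_bar\<close> the bar acts on the function values
  alone; invariance of the weight lets it be pulled out of the whole sum.\<close>

lemma barK_mu1_weight: "barK (mu1_weight n) = mu1_weight n"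
proof -
  have "barK ((1 - Q * tK\<^sup>2) / (tK * (1 - Q))) = (1 - Q * tK\<^sup>2) / (tK * (1 - Q))"
    if Q: "Q = qK ^ Suc i" for i Q
  proof -
    have nz: "Q \<noteq> 0" "tK \<noteq> 0" by (simp_all add: Q)
    have b: "barK Q = inverse Q" "barK tK = inverse tK"
      by (simp_all add: Q barK_mult barK_power barK_qh barK_th field_simps)
    have id: "(1 - inverse Q * (inverse t)\<^sup>2) / (inverse t * (1 - inverse Q)) = (1 - Q * t\<^sup>2) / (t * (1 - Q))"
      if "Q \<noteq> 0" "t \<noteq> 0" "1 - Q \<noteq> 0" for Q t :: K
    proof -
      have 1: "1 - inverse Q * (inverse t)\<^sup>2 = (Q * t\<^sup>2 - 1) / (Q * t\<^sup>2)"
        "inverse t * (1 - inverse Q) = t * (Q - 1) / (Q * t\<^sup>2)"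
        using that by (simp_all add: field_simps power2_eq_square)
      show ?thesis unfolding 1 using that by (simp add: divide_simps) (simp add: algebra_simps)
    qed
    show ?thesis
      unfolding barK_divide barK_mult barK_diff barK_1 barK_power[of tK 2] b
      using nz qpoch_nonzero(4)[of i, folded Q] by (rule id)
  qed
  then show ?thesis by (simp add: mu1_weight_def barK_prod del: power_Suc)
qed

text \<open>The factors 1 - Q of norm and weight cancel, leaving a value at -k/2 times its bar. This
  is why division by that value turns the norms into reciprocal weights.\<close>

lemma norm_weight:
  "qA k 1 * qB k * (\<Prod>i<k. (1 - qK ^ Suc i * tK\<^sup>2) / (tK * (1 - qK ^ Suc i))) =
   phi_at_sharp0 k * barK (phi_at_sharp0 k)"
proof -
  have id: "(1 - Q * 1) / (1 - Q * 1 * t) * ((1 - Q * t\<^sup>2) / (1 - Q * t)) * ((1 - Q * t\<^sup>2) / (t * (1 - Q))) =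
    (1 - Q * t\<^sup>2) / (t * (1 - Q * t)) * ((1 - Q * t\<^sup>2) / (1 - Q * t))"
    if "1 - Q \<noteq> 0" for Q t :: K
    using that by simp
  show ?thesis
    unfolding barK_phi_at_sharp0 unfolding phi_at_sharp0_def qA_def qB_def prod.distrib[symmetric]
    using qpoch_nonzero(4) by (intro prod.cong refl id)
qed

lemma eps_orthogonal:
  "const_term (eps n * barP (eps m)) mu0 = (if n = m then inverse (mu1_weight n) else 0)"
proof -
  let ?c = "\<lambda>n. evalP (e_poly n) (sharp 0)"
  have "eps n * barP (eps m) =
      scale (inverse (?c n)) (scale (inverse (barK (?c m))) (e_explicit n * barP (e_explicit m)))"
    unfolding eps_def barP_scale barK_inverse e_poly_eq by (simp only: ac_simps)
  then have *: "const_term (eps n * barP (eps m)) mu0 =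
      inverse (?c n) * (inverse (barK (?c m)) * (if n = m then qA (szego_index n) 1 * qB (szego_index n) else 0))"
    by (simp only: const_term_scale e_explicit_gram)
  show ?thesis
  proof (cases "n = m")
    case True
    let ?k = "szego_index n" and ?a = "if n > 0 then 2 - n else n"
    \<comment> \<open>The power of t^(-1/2) in the value of the polynomial is undone by its
      bar.\<close>
    have "inverse th powi ?a * th powi ?a = 1"
      by (simp flip: power_int_mult_distrib)
    then have "?c n * barK (?c n) = phi_at_sharp0 ?k * barK (phi_at_sharp0 ?k)"
      unfolding evalP_e_poly barK_mult barK_powi barK_inverse barK_th inverse_inverse_eq
      by (metis (no_types, lifting) mult.assoc mult.left_commute mult_1)
    also have "\<dots> = qA ?k 1 * qB ?k * mu1_weight n"
      unfolding mu1_weight_def by (rule norm_weight[symmetric])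
    finally have c: "?c n * barK (?c n) = qA ?k 1 * qB ?k * mu1_weight n" .
    have "const_term (eps n * barP (eps m)) mu0 = qA ?k 1 * qB ?k / (?c n * barK (?c n))"
      unfolding * using True by (simp add: field_simps)
    then show ?thesis
      unfolding c using True e_explicit_norm_nonzero[of ?k] by (simp add: field_simps)
  qed (simp add: *)
qed

lemma eps_span: "\<exists>A c. finite A \<and> f = (\<Sum>m\<in>A. scale (c m) (eps m))"
proof -
  define r where "r = Suc (Max (rank ` Poly_Mapping.keys f))"
  have "rank m < r" if "m \<in> Poly_Mapping.keys f" for m
    using that unfolding r_def by (intro le_imp_less_Suc Max_ge) auto
  then obtain c where c: "f = (\<Sum>m | rank m < r. scale (c m) (e_explicit m))"
    using e_explicit_span by blast
  let ?c = "\<lambda>m. evalP (e_poly m) (sharp 0)"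
  have "?c m \<noteq> 0" for m
    using phi_at_sharp0_nonzero by (simp add: evalP_e_poly power_int_not_zero)
  note nz = this
  have "scale (c m) (e_explicit m) = scale (c m * ?c m) (eps m)" for m
  proof -
    have "c m * evalP (e_explicit m) (sharp 0) * inverse (evalP (e_explicit m) (sharp 0)) = c m"
      using nz[of m] by (simp add: mult.assoc e_poly_eq)
    then show ?thesis
      unfolding eps_def e_poly_eq mult.assoc[symmetric] mult_single by (simp only: add_0)
  qed
  then have "f = (\<Sum>m | rank m < r. scale (c m * ?c m) (eps m))"
    unfolding c by (intro sum.cong refl)
  with finite_rank[of r] show ?thesis by (intro exI conjI)
qed

lemma eps_bar_span: "\<exists>A c. finite A \<and> f = (\<Sum>m\<in>A. scale (c m) (barP (eps m)))"
proof -
  obtain A c where A: "finite A" "barP f = (\<Sum>m\<in>A. scale (c m) (eps m))"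
    using eps_span by blast
  have "f = barP (\<Sum>m\<in>A. scale (c m) (eps m))"
    unfolding A(2)[symmetric] by simp
  also have "\<dots> = (\<Sum>m\<in>A. scale (barK (c m)) (barP (eps m)))"
    unfolding barP_sum barP_scale ..
  finally have "f = (\<Sum>m\<in>A. scale (barK (c m)) (barP (eps m)))" .
  with A(1) show ?thesis by (intro exI conjI)
qed

section \<open>Finitely supported functions and inversion\<close>

lemma on_Zsharp_Fspace: "finite {n. g n \<noteq> 0} \<Longrightarrow> on_Zsharp g \<in> Fspace"
proof -
  assume fin: "finite {n. g n \<noteq> 0}"
  have "{z. on_Zsharp g z \<noteq> 0} \<subseteq> sharp ` {n. g n \<noteq> 0}"
  proof
    fix z assume "z \<in> {z. on_Zsharp g z \<noteq> 0}"
    moreover from this obtain n where "z = sharp n"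
      by (auto simp: on_Zsharp_def Zsharp_def split: if_splits)
    ultimately show "z \<in> sharp ` {n. g n \<noteq> 0}" by simp
  qed
  then show ?thesis
    unfolding Fspace_def Zsharp_def using fin finite_surj by blast
qed

lemma Fspace_eqI: "f \<in> Fspace \<Longrightarrow> on_Zsharp (\<lambda>n. f (sharp n)) = f"
proof
  fix z assume "f \<in> Fspace"
  then show "on_Zsharp (\<lambda>n. f (sharp n)) z = f z"
  proof (cases "z \<in> Zsharp")
    case True
    then obtain n where "z = sharp n" by (auto simp: Zsharp_def)
    then show ?thesis by simp
  qed (auto simp: Fspace_def on_Zsharp_def)
qed

lemma finite_sharp_support: "f \<in> Fspace \<Longrightarrow> finite {n. f (sharp n) \<noteq> 0}"
  using finite_vimageI[OF _ inj_sharp, of "{z. f z \<noteq> 0}"] by (simp add: Fspace_def vimage_def)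

text \<open>Pairing with x gives the coefficients along y divided by the weight, and the weight in
  \<open>I\<close> restores them. Finite expansions along y make \<open>S f\<close> finitely
  supported.\<close>

lemma biorthogonal_inversion:
  fixes x y :: "int \<Rightarrow> laurent"
  assumes orth: "\<And>n m. const_term (y m * x n) mu0 = (if n = m then inverse (mu1_weight n) else 0)"
    and span: "\<And>f. \<exists>A c. finite A \<and> f = (\<Sum>m\<in>A. scale (c m) (y m))"
  defines "S \<equiv> \<lambda>f. on_Zsharp (\<lambda>n. const_term (f * x n) mu0)"
    and "I \<equiv> \<lambda>g. \<Sum>n | g (sharp n) \<noteq> 0. scale (g (sharp n) * mu1 (sharp n)) (y n)"
  shows "S f \<in> Fspace" "I (S f) = f" "g \<in> Fspace \<Longrightarrow> S (I g) = g"
proof -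
  have ct: "const_term ((\<Sum>m\<in>A. scale (c m) (y m)) * x n) mu0 = (if n \<in> A then c n / mu1_weight n else 0)"
    if "finite A" for A c n
  proof -
    have "const_term ((\<Sum>m\<in>A. scale (c m) (y m)) * x n) mu0 = (\<Sum>m\<in>A. const_term (scale (c m) (y m * x n)) mu0)"
      unfolding sum_distrib_right const_term_sum by (simp only: mult.assoc)
    also have "\<dots> = (\<Sum>m\<in>A. if m = n then c n / mu1_weight n else 0)"
      unfolding const_term_scale orth by (intro sum.cong refl) (auto simp: divide_inverse)
    finally show ?thesis using that by simp
  qed
  obtain A c where A: "finite A" and f: "f = (\<Sum>m\<in>A. scale (c m) (y m))"
    using span by blast
  have Sf: "S f (sharp n) = (if n \<in> A then c n / mu1_weight n else 0)" for n
    unfolding S_def on_Zsharp_sharp unfolding f by (rule ct[OF A])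
  show "S f \<in> Fspace"
    unfolding S_def
  proof (rule on_Zsharp_Fspace)
    show "finite {n. const_term (f * x n) mu0 \<noteq> 0}"
      by (rule finite_subset[OF _ A]) (use ct[OF A, of c] f in auto)
  qed
  have "I (S f) = (\<Sum>n | S f (sharp n) \<noteq> 0. scale (c n) (y n))"
    unfolding I_def mu1_sharp using mu1_weight_nonzero by (intro sum.cong refl) (auto simp: Sf split: if_splits)
  also have "\<dots> = f"
    unfolding f using A mu1_weight_nonzero by (intro sum.mono_neutral_left) (auto simp: Sf[unfolded f] split: if_splits)
  finally show "I (S f) = f" .
  assume g: "g \<in> Fspace"
  have "const_term (I g * x n) mu0 = g (sharp n)" for n
    unfolding I_def mu1_sharp ct[OF finite_sharp_support[OF g]] using mu1_weight_nonzero by simp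
  then show "S (I g) = g"
    unfolding S_def using Fspace_eqI[OF g] by simp
qed

lemma eps_orthogonal':
  "const_term (barP (eps m) * eps n) mu0 = (if n = m then inverse (mu1_weight n) else 0)"
  "const_term (eps m * barP (eps n)) mu0 = (if n = m then inverse (mu1_weight n) else 0)"
  by (auto simp: mult.commute[of "barP _"] eps_orthogonal)

text \<open>Together with \<open>E0_eq\<close> this reduces the inversions of the E-transforms to
  those of the S-transforms: the two bars meet and cancel.\<close>

lemma E1_eq: "E1 g = barP (S1_bar g)" and E1_bar_eq: "E1_bar g = barP (S1 g)"
  by (simp_all only: E1_def E1_bar_def S1_def S1_bar_def barP_sum barP_scale barK_mult mu1_sharp barK_mu1_weight barP_barP)

lemma E0_eq: "E0 f = S0 (barP f)" and E0_bar_eq: "E0_bar f = S0_bar (barP f)"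
  by (simp_all only: E0_def S0_def E0_bar_def S0_bar_def)

theorem theorem7p13:
  shows "(S0 \<in> UNIV \<rightarrow> Fspace \<and> S0_bar \<in> UNIV \<rightarrow> Fspace \<and>
          E0 \<in> UNIV \<rightarrow> Fspace \<and> E0_bar \<in> UNIV \<rightarrow> Fspace) \<and>
         (S1_bar \<circ> S0 = id \<and> S1 \<circ> S0_bar = id) \<and>
         (\<forall>f\<in>Fspace. (S0_bar \<circ> S1) f = id f \<and> (S0 \<circ> S1_bar) f = id f) \<and>
         (E1 \<circ> E0 = id \<and> E1_bar \<circ> E0_bar = id) \<and>
         (\<forall>f\<in>Fspace. (E0 \<circ> E1) f = id f \<and> (E0_bar \<circ> E1_bar) f = id f)"
proof -
  \<comment> \<open>The two families change roles between the instances: \<open>S0\<close> pairs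
    with \<open>eps\<close> and is inverted along the conjugates, \<open>S0_bar\<close> the other
    way round.\<close>
  note inv = biorthogonal_inversion[OF eps_orthogonal'(1) eps_bar_span, folded S0_def S1_bar_def]
    biorthogonal_inversion[OF eps_orthogonal'(2) eps_span, folded S0_bar_def S1_def]
  show ?thesis
    by (auto simp: fun_eq_iff E0_eq E0_bar_eq E1_eq E1_bar_eq inv)
qed

end
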